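(* Let $N$ be an infinite supernatural number and let $d:\mathcal A(N)\to A(N)$ be a derivation in the Bunce-Deddens-Toeplitz algebra $A(N)$. Then there exists a unique constant $C\in\mathbb C$ such that $$d(a)=C[\mathbb K,a]+\tilde d(a)\qquad (a\in\mathcal A(N)),$$ where $\tilde d:\mathcal A(N)\to A(N)$ is an approximately inner derivation.
   Context: A supernatural number is a formal product $N=\prod_{p\text{ prime}}p^{\epsilon_p}$ with $\epsilon_p\in\{0,1,\dots,\infty\}$; it is finite (an ordinary positive integer) if $\sum_p\epsilon_p<\infty$, and infinite otherwise. A positive integer $j$ divides $N$ ($j\mid N$) if for each prime $p$ the exponent of $p$ in $j$ is at most $\epsilon_p$. On $\ell^2(\mathbb Z_{\ge0})$ with canonical basis $\{E_k\}_{k\ge 0}$ let $UE_k=E_{k+1}$ be the unilateral shift, let $\mathbb K E_k=kE_k$, and for a sequence $a(k)$ let $a(\mathbb K)E_k=a(k)E_k$. Let $\mathcal A_{\mathrm{diag,per}}(N)=\{a(\mathbb K): a \text{ is } j\text{-periodic for some positive integer } j\mid N\}$. $A(N)$ is the C$^*$-algebra of operators on $\ell^2(\mathbb Z_{\ge0})$ generated by $U$ and $\mathcal A_{\mathrm{diag,per}}(N)$; $\mathcal A(N)$ is the dense $^*$-subalgebra generated algebraically by $U,U^*$ and $\mathcal A_{\mathrm{diag,per}}(N)$. A derivation in $A(N)$ is a linear map $d:\mathcal A(N)\to A(N)$ with $d(ab)=d(a)b+a\,d(b)$ for all $a,b\in\mathcal A(N)$. It is approximately inner if there are $a_n\in A(N)$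 with $d(a)=\lim_{n\to\infty}[a_n,a]$ (in norm) for every $a\in\mathcal A(N)$. For $a\in\mathcal A(N)$ the commutator $[\mathbb K,a]$, computed on the linear span of $\{E_k\}$, extends to a bounded operator in $A(N)$. *)

theory Defs
  imports "HOL-Analysis.Analysis" "HOL-Computational_Algebra.Primes"
begin

section \<open>The complex Hilbert space of square-summable sequences\<close>

lemma summable_mult_cnj:
  fixes x y :: "nat \<Rightarrow> complex"
  assumes "summable (\<lambda>k. (cmod (x k))\<^sup>2)" "summable (\<lambda>k. (cmod (y k))\<^sup>2)"
  shows "summable (\<lambda>k. cmod (x k * cnj (y k)))"
proof (rule summable_comparison_test')
  show "summable (\<lambda>k. (cmod (x k))\<^sup>2 + (cmod (y k))\<^sup>2)"
    using assms by (rule summable_add)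
  fix k
  have "0 \<le> (cmod (x k) - cmod (y k))\<^sup>2" by simp
  then have "2 * (cmod (x k) * cmod (y k)) \<le> (cmod (x k))\<^sup>2 + (cmod (y k))\<^sup>2"
    by (simp add: power2_diff)
  moreover have "0 \<le> cmod (x k) * cmod (y k)" by simp
  ultimately have "cmod (x k) * cmod (y k) \<le> (cmod (x k))\<^sup>2 + (cmod (y k))\<^sup>2"
    by linarith
  then show "norm (cmod (x k * cnj (y k))) \<le> (cmod (x k))\<^sup>2 + (cmod (y k))\<^sup>2"
    by (simp add: norm_mult)
qed

typedef ell2 = "{x :: nat \<Rightarrow> complex. summable (\<lambda>k. (cmod (x k))\<^sup>2)}"
  morphisms coord Abs_ell2
  by (rule exI[of _ "\<lambda>_. 0"]) simp

setup_lifting type_definition_ell2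

lemma ell2_eqI: "(\<And>k. coord x k = coord y k) \<Longrightarrow> x = y"
  by transfer auto

lemma summable_coord: "summable (\<lambda>k. (cmod (coord x k))\<^sup>2)"
  using coord[of x] by simp

lemma square_summable_add:
  fixes x y :: "nat \<Rightarrow> complex"
  assumes "summable (\<lambda>k. (cmod (x k))\<^sup>2)" "summable (\<lambda>k. (cmod (y k))\<^sup>2)"
  shows "summable (\<lambda>k. (cmod (x k + y k))\<^sup>2)"
proof (rule summable_comparison_test')
  show "summable (\<lambda>k. 2 * (cmod (x k))\<^sup>2 + 2 * (cmod (y k))\<^sup>2)"
    using assms by (intro summable_add summable_mult)
  fix k
  have "(cmod (x k + y k))\<^sup>2 \<le> (cmod (x k) + cmod (y k))\<^sup>2"
    by (intro power_mono norm_triangle_ineq) simp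
  also have "\<dots> \<le> 2 * (cmod (x k))\<^sup>2 + 2 * (cmod (y k))\<^sup>2"
    using zero_le_power2[of "cmod (x k) - cmod (y k)"]
    by (simp add: power2_diff power2_sum)
  finally show "norm ((cmod (x k + y k))\<^sup>2) \<le> 2 * (cmod (x k))\<^sup>2 + 2 * (cmod (y k))\<^sup>2"
    by simp
qed

lift_definition scaleC :: "complex \<Rightarrow> ell2 \<Rightarrow> ell2"  (infixr \<open>*\<^sub>C\<close> 75)
  is "\<lambda>c x k. c * x k"
  by (simp add: norm_mult power_mult_distrib summable_mult)

lift_definition cinner :: "ell2 \<Rightarrow> ell2 \<Rightarrow> complex"
  is "\<lambda>x y. \<Sum>k. x k * cnj (y k)" .

instantiation ell2 :: real_inner
begin

lift_definition zero_ell2 :: ell2 is "\<lambda>_. 0" by simp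
lift_definition plus_ell2 :: "ell2 \<Rightarrow> ell2 \<Rightarrow> ell2" is "\<lambda>x y k. x k + y k"
  by (rule square_summable_add)
lift_definition uminus_ell2 :: "ell2 \<Rightarrow> ell2" is "\<lambda>x k. - x k" by simp
lift_definition minus_ell2 :: "ell2 \<Rightarrow> ell2 \<Rightarrow> ell2" is "\<lambda>x y k. x k - y k"
proof -
  fix x y :: "nat \<Rightarrow> complex"
  assume "summable (\<lambda>k. (cmod (x k))\<^sup>2)" "summable (\<lambda>k. (cmod (y k))\<^sup>2)"
  then show "summable (\<lambda>k. (cmod (x k - y k))\<^sup>2)"
    using square_summable_add[of x "\<lambda>k. - y k"] by simp
qed
definition scaleR_ell2 :: "real \<Rightarrow> ell2 \<Rightarrow> ell2" where
  "scaleR_ell2 r x = complex_of_real r *\<^sub>C x"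
definition inner_ell2 :: "ell2 \<Rightarrow> ell2 \<Rightarrow> real" where
  "inner_ell2 x y = Re (cinner x y)"
definition norm_ell2 :: "ell2 \<Rightarrow> real" where
  "norm_ell2 x = sqrt (inner x x)"
definition sgn_ell2 :: "ell2 \<Rightarrow> ell2" where
  "sgn_ell2 x = scaleR (inverse (norm x)) x"
definition dist_ell2 :: "ell2 \<Rightarrow> ell2 \<Rightarrow> real" where
  "dist_ell2 x y = norm (x - y)"
definition uniformity_ell2 :: "(ell2 \<times> ell2) filter" where
  "uniformity_ell2 = (INF e\<in>{0<..}. principal {(x, y). dist x y < e})"
definition open_ell2 :: "ell2 set \<Rightarrow> bool" where
  "open_ell2 U = (\<forall>x\<in>U. \<forall>\<^sub>F (x', y) in uniformity. x' = x \<longrightarrow> y \<in> U)"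

lemma summable_cinner: "summable (\<lambda>k. coord x k * cnj (coord y k))"
  by (rule summable_norm_cancel[OF summable_mult_cnj[OF summable_coord summable_coord]])

lemma cinner_sums: "(\<lambda>k. coord x k * cnj (coord y k)) sums cinner x y"
  unfolding cinner.rep_eq using summable_cinner by (rule summable_sums)

lemma inner_self_sums: "(\<lambda>k. (cmod (coord x k))\<^sup>2) sums inner x x"
  using sums_Re[OF cinner_sums[of x x]]
  by (simp add: inner_ell2_def complex_mult_cnj cmod_power2)

instance
proof
  fix x y z :: ell2 and a b r :: real
  show "x + y + z = x + (y + z)" by transfer (simp add: add.assoc)
  show "x + y = y + x" by transfer (simp add: add.commute)
  show "0 + x = x" by transfer simp
  show "- x + x = 0" by transfer simp
  show "x - y = x + - y" by transfer simp
  show "a *\<^sub>R (x + y) = a *\<^sub>R x + a *\<^sub>R y"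
    unfolding scaleR_ell2_def by transfer (simp add: distrib_left)
  show "(a + b) *\<^sub>R x = a *\<^sub>R x + b *\<^sub>R x"
    unfolding scaleR_ell2_def by transfer (simp add: distrib_right)
  show "a *\<^sub>R b *\<^sub>R x = (a * b) *\<^sub>R x"
    unfolding scaleR_ell2_def by transfer (simp add: mult.assoc)
  show "1 *\<^sub>R x = x" unfolding scaleR_ell2_def by transfer simp
  show "dist x y = norm (x - y)" by (rule dist_ell2_def)
  show "sgn x = scaleR (inverse (norm x)) x" by (rule sgn_ell2_def)
  show "uniformity = (INF e\<in>{0<..}. principal {(x :: ell2, y). dist x y < e})"
    by (rule uniformity_ell2_def)
  show "open U = (\<forall>x\<in>U. \<forall>\<^sub>F (x', y) in uniformity. x' = x \<longrightarrow> y \<in> U)" for U :: "ell2 set"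
    by (rule open_ell2_def)
  have "cinner y x = cnj (cinner x y)"
    using sums_unique2[OF cinner_sums[of y x]] sums_cnj[of "\<lambda>k. coord x k * cnj (coord y k)" "cinner x y"]
      cinner_sums[of x y]
    by (simp add: mult.commute)
  then show "inner x y = inner y x" by (simp add: inner_ell2_def)
  have "cinner (x + y) z = cinner x z + cinner y z"
    using sums_unique2[OF cinner_sums[of "x + y" z]] sums_add[OF cinner_sums[of x z] cinner_sums[of y z]]
    by (simp add: plus_ell2.rep_eq distrib_right)
  then show "inner (x + y) z = inner x z + inner y z" by (simp add: inner_ell2_def)
  have "cinner (r *\<^sub>R x) y = r * cinner x y"
    using sums_unique2[OF cinner_sums[of "r *\<^sub>R x" y]]
      sums_mult[OF cinner_sums[of x y], of "complex_of_real r"]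
    by (simp add: scaleR_ell2_def scaleC.rep_eq mult.assoc)
  then show "inner (r *\<^sub>R x) y = r * inner x y" by (simp add: inner_ell2_def)
  show "0 \<le> inner x x"
    using inner_self_sums[of x] by (rule sums_le[OF _ sums_zero, rotated]) simp
  show "inner x x = 0 \<longleftrightarrow> x = 0"
  proof
    assume "inner x x = 0"
    then have "\<forall>k. (cmod (coord x k))\<^sup>2 = 0"
      using inner_self_sums[of x] suminf_eq_zero_iff[OF summable_coord[of x]] sums_unique by fastforce
    then show "x = 0" by (intro ell2_eqI) (simp add: zero_ell2.rep_eq)
  next
    assume "x = 0"
    then show "inner x x = 0"
      using inner_self_sums[of x] sums_unique2[OF _ sums_zero] by (simp add: zero_ell2.rep_eq)
  qed
  show "norm x = sqrt (inner x x)" by (rule norm_ell2_def)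
qed

end

lemmas coord_simps [simp] = zero_ell2.rep_eq plus_ell2.rep_eq uminus_ell2.rep_eq
  minus_ell2.rep_eq scaleC.rep_eq

lemma coord_scaleR [simp]: "coord (r *\<^sub>R x) k = of_real r * coord x k"
  by (simp add: scaleR_ell2_def)

lemma coord_sum [simp]: "coord (sum f A) k = (\<Sum>a\<in>A. coord (f a) k)"
  by (induction A rule: infinite_finite_induct) auto

lemma norm_sums: "(\<lambda>k. (cmod (coord x k))\<^sup>2) sums (norm x)\<^sup>2"
  using inner_self_sums[of x] by (simp add: power2_norm_eq_inner)

lemma norm_coord_le: "cmod (coord x k) \<le> norm x"
proof -
  have "(\<Sum>i\<in>{k}. (cmod (coord x i))\<^sup>2) \<le> (\<Sum>i. (cmod (coord x i))\<^sup>2)"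
    by (rule sum_le_suminf[OF summable_coord]) auto
  then show ?thesis
    using sums_unique[OF norm_sums[of x]] by (auto intro: power2_le_imp_le)
qed

lemma ell2_of_partial_sums:
  assumes "\<And>K. (\<Sum>k<K. (cmod (f k))\<^sup>2) \<le> e\<^sup>2" and "0 \<le> e"
  obtains x where "coord x = f" "norm x \<le> e"
proof -
  have s: "summable (\<lambda>k. (cmod (f k))\<^sup>2)"
    using assms(1) by (intro summableI_nonneg_bounded[of _ "e\<^sup>2"]) auto
  then have c: "coord (Abs_ell2 f) = f" by (simp add: Abs_ell2_inverse)
  have "(norm (Abs_ell2 f))\<^sup>2 \<le> e\<^sup>2"
    using suminf_le_const[OF s assms(1)] sums_unique[OF norm_sums[of "Abs_ell2 f"]] by (simp add: c)
  then have "norm (Abs_ell2 f) \<le> e" using assms(2) by (rule power2_le_imp_le)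
  with c that show ?thesis by blast
qed

instance ell2 :: banach
proof
  fix X :: "nat \<Rightarrow> ell2"
  assume X: "Cauchy X"
  have "Cauchy (\<lambda>n. coord (X n) k)" for k
    unfolding Cauchy_def
  proof (intro allI impI)
    fix e :: real assume "e > 0"
    then obtain M where M: "\<And>m n. m \<ge> M \<Longrightarrow> n \<ge> M \<Longrightarrow> dist (X m) (X n) < e"
      using X unfolding Cauchy_def by blast
    have "dist (coord (X m) k) (coord (X n) k) \<le> dist (X m) (X n)" for m n
      using norm_coord_le[of "X m - X n" k] by (simp add: dist_norm)
    then show "\<exists>M. \<forall>m\<ge>M. \<forall>n\<ge>M. dist (coord (X m) k) (coord (X n) k) < e"
      using M by (meson order.strict_trans1)
  qed
  then have "\<forall>k. \<exists>l. (\<lambda>n. coord (X n) k) \<longlonglongrightarrow> l"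
    using Cauchy_convergent convergent_def by metis
  then obtain f where f: "\<And>k. (\<lambda>n. coord (X n) k) \<longlonglongrightarrow> f k" by metis
  have key: "\<exists>z. coord z = (\<lambda>k. coord (X m) k - f k) \<and> norm z \<le> e"
    if e0: "e > 0" and mM: "m \<ge> M" and M: "\<And>m n. m \<ge> M \<Longrightarrow> n \<ge> M \<Longrightarrow> dist (X m) (X n) < e" for e m M
  proof -
    have "(\<Sum>k<K. (cmod (coord (X m) k - f k))\<^sup>2) \<le> e\<^sup>2" for K
    proof (rule tendsto_upperbound)
      show "(\<lambda>n. \<Sum>k<K. (cmod (coord (X m) k - coord (X n) k))\<^sup>2)
          \<longlonglongrightarrow> (\<Sum>k<K. (cmod (coord (X m) k - f k))\<^sup>2)"
        by (intro tendsto_intros f)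
      show "\<forall>\<^sub>F n in sequentially. (\<Sum>k<K. (cmod (coord (X m) k - coord (X n) k))\<^sup>2) \<le> e\<^sup>2"
        using eventually_ge_at_top[of M]
      proof eventually_elim
        case (elim n)
        have "(\<Sum>k<K. (cmod (coord (X m - X n) k))\<^sup>2) \<le> (norm (X m - X n))\<^sup>2"
          using sum_le_suminf[OF summable_coord[of "X m - X n"], of "{..<K}"]
            sums_unique[OF norm_sums[of "X m - X n"]] by simp
        also have "\<dots> \<le> e\<^sup>2"
          using M[OF mM elim] by (intro power_mono) (auto simp: dist_norm)
        finally show ?case by simp
      qed
    qed simp
    then obtain z where "coord z = (\<lambda>k. coord (X m) k - f k)" "norm z \<le> e"
      by (rule ell2_of_partial_sums) (rule less_imp_le[OF e0])
    then show ?thesis by blast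
  qed
  obtain M where "\<And>m n. m \<ge> M \<Longrightarrow> n \<ge> M \<Longrightarrow> dist (X m) (X n) < 1"
    using X unfolding Cauchy_def by (metis zero_less_one)
  then obtain z where z: "coord z = (\<lambda>k. coord (X M) k - f k)" using key[of 1 M M] by auto
  define L where "L = X M - z"
  have L: "coord L k = f k" for k by (simp add: L_def z)
  have "X \<longlonglongrightarrow> L"
  proof (rule metric_LIMSEQ_I)
    fix r :: real assume r: "0 < r"
    then obtain M where M: "\<And>m n. m \<ge> M \<Longrightarrow> n \<ge> M \<Longrightarrow> dist (X m) (X n) < r / 2"
      using X unfolding Cauchy_def by (meson half_gt_zero)
    show "\<exists>no. \<forall>n\<ge>no. dist (X n) L < r"
    proof (intro exI allI impI)
      fix n assume "n \<ge> M"
      then obtain z where z: "coord z = (\<lambda>k. coord (X n) k - f k)" "norm z \<le> r / 2"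
        using key[of "r / 2" M n] r M by auto
      have "X n - L = z" by (rule ell2_eqI) (simp add: z(1) L)
      then show "dist (X n) L < r" using z(2) r by (simp add: dist_norm)
    qed
  qed
  then show "convergent X" by (auto simp: convergent_def)
qed

global_interpretation ell2: vector_space scaleC
proof
qed (rule ell2_eqI, simp add: algebra_simps)+

lemma norm_scaleC: "norm (c *\<^sub>C x) = cmod c * norm x"
proof -
  have "(\<lambda>k. (cmod c)\<^sup>2 * (cmod (coord x k))\<^sup>2) sums ((cmod c)\<^sup>2 * (norm x)\<^sup>2)"
    by (intro sums_mult norm_sums)
  then have "(norm (c *\<^sub>C x))\<^sup>2 = (cmod c * norm x)\<^sup>2"
    using sums_unique2[OF norm_sums[of "c *\<^sub>C x"]] by (simp add: norm_mult power_mult_distrib)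
  then show ?thesis by (simp add: power2_eq_iff_nonneg)
qed

lemma scaleR_scaleC: "r *\<^sub>R x = complex_of_real r *\<^sub>C x"
  by (rule scaleR_ell2_def)


lemma bounded_linear_scaleC: "bounded_linear (scaleC c)"
  by (rule bounded_linear_intro[of _ "cmod c"])
    (simp_all add: ell2.scale_right_distrib scaleR_scaleC norm_scaleC ac_simps)

lemma cinner_commute: "cinner y x = cnj (cinner x y)"
  using sums_unique2[OF cinner_sums[of y x]] sums_cnj[of "\<lambda>k. coord x k * cnj (coord y k)" "cinner x y"]
    cinner_sums[of x y]
  by (simp add: mult.commute)

lemma cinner_add_left: "cinner (x + y) z = cinner x z + cinner y z"
  using sums_unique2[OF cinner_sums[of "x + y" z]] sums_add[OF cinner_sums[of x z] cinner_sums[of y z]]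
  by (simp add: distrib_right)

lemma cinner_scaleC_left: "cinner (c *\<^sub>C x) y = c * cinner x y"
  using sums_unique2[OF cinner_sums[of "c *\<^sub>C x" y]] sums_mult[OF cinner_sums[of x y], of c]
  by (simp add: mult.assoc)

lemma cinner_add_right: "cinner z (x + y) = cinner z x + cinner z y"
  by (metis cinner_add_left cinner_commute complex_cnj_add)

lemma cinner_scaleC_right: "cinner x (c *\<^sub>C y) = cnj c * cinner x y"
  by (metis cinner_scaleC_left cinner_commute complex_cnj_mult)

lemma cinner_zero [simp]: "cinner 0 x = 0" "cinner x 0 = 0"
  using cinner_scaleC_left[of 0 x x] cinner_scaleC_right[of x 0 x] by simp_all

lemma cinner_diff_left: "cinner (x - y) z = cinner x z - cinner y z"
  using cinner_add_left[of "x - y" y z] by simp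

lemma cinner_diff_right: "cinner z (x - y) = cinner z x - cinner z y"
  using cinner_add_right[of z "x - y" y] by simp

lemma cinner_self: "cinner x x = of_real ((norm x)\<^sup>2)"
proof -
  have "(\<lambda>k. complex_of_real ((cmod (coord x k))\<^sup>2)) sums of_real ((norm x)\<^sup>2)"
    by (rule sums_of_real[OF norm_sums])
  then show ?thesis
    using sums_unique2[OF cinner_sums[of x x]] by (simp flip: complex_norm_square)
qed

lemma norm_cinner_le: "cmod (cinner x y) \<le> norm x * norm y"
proof (cases "cinner x y = 0")
  case False
  define c where "c = cnj (cinner x y) / cmod (cinner x y)"
  have "cinner (c *\<^sub>C x) y = of_real (cmod (cinner x y))"
    using False
    by (simp add: cinner_scaleC_left c_def mult.commute[of "cnj _"] power2_eq_square flip: complex_norm_square)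
  then have "cmod (cinner x y) = inner (c *\<^sub>C x) y" by (simp add: inner_ell2_def)
  also have "\<dots> \<le> norm (c *\<^sub>C x) * norm y" by (rule norm_cauchy_schwarz)
  also have "norm (c *\<^sub>C x) = norm x" using False by (simp add: norm_scaleC c_def norm_divide)
  finally show ?thesis .
qed simp

lemma cinner_eqI: "(\<And>z. cinner x z = cinner y z) \<Longrightarrow> x = y"
  using cinner_self[of "x - y"] by (simp add: cinner_diff_left)


section \<open>Bounded operators\<close>

text \<open>The real vector spaces \<^typ>\<open>ell2\<close> and \<^typ>\<open>ell2 \<Rightarrow>\<^sub>L ell2\<close> carry the usual norms, since the
  norm of \<^typ>\<open>ell2\<close> is induced by \<^const>\<open>cinner\<close>. The bounded operators on the complex Hilbert
  space are the complex-linear elements of \<^typ>\<open>ell2 \<Rightarrow>\<^sub>L ell2\<close>.\<close>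

definition bounded_ops :: "(ell2 \<Rightarrow>\<^sub>L ell2) set" where
  "bounded_ops = {T :: ell2 \<Rightarrow>\<^sub>L ell2. \<forall>c x. T (c *\<^sub>C x) = c *\<^sub>C T x}"

definition scaleC_op :: "complex \<Rightarrow> (ell2 \<Rightarrow>\<^sub>L ell2) \<Rightarrow> (ell2 \<Rightarrow>\<^sub>L ell2)"  (infixr \<open>\<cdot>\<^sub>C\<close> 75)
  where "c \<cdot>\<^sub>C T = Blinfun (\<lambda>x. c *\<^sub>C T x)"

lemma scaleC_op_apply [simp]: "(c \<cdot>\<^sub>C T) x = c *\<^sub>C T x"
  unfolding scaleC_op_def
  by (subst bounded_linear_Blinfun_apply)
    (auto intro: bounded_linear_compose[OF bounded_linear_scaleC] blinfun.bounded_linear_right)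

definition commutator :: "(ell2 \<Rightarrow>\<^sub>L ell2) \<Rightarrow> (ell2 \<Rightarrow>\<^sub>L ell2) \<Rightarrow> (ell2 \<Rightarrow>\<^sub>L ell2)" where
  "commutator S T = (S o\<^sub>L T) - (T o\<^sub>L S)"

definition adj :: "(ell2 \<Rightarrow>\<^sub>L ell2) \<Rightarrow> (ell2 \<Rightarrow>\<^sub>L ell2)" where
  "adj T = (THE S :: ell2 \<Rightarrow>\<^sub>L ell2. \<forall>x y. cinner (S x) y = cinner x (T y))"

lift_definition basis :: "nat \<Rightarrow> ell2" is "\<lambda>k n. if n = k then 1 else 0"
proof -
  fix k :: nat
  have "(\<lambda>n::nat. (cmod (if n = k then 1 else 0))\<^sup>2) = (\<lambda>n. if n = k then 1 else 0)" by auto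
  then show "summable (\<lambda>n::nat. (cmod (if n = k then 1 else 0))\<^sup>2)" by simp
qed

lemma basis_trunc: "coord (\<Sum>k<K. f k *\<^sub>C basis k) n = (if n < K then f n else 0)"
  by (simp add: basis.rep_eq if_distrib[of "\<lambda>x. _ * x"] cong: if_cong)

lemma trunc_tendsto: "(\<lambda>K. \<Sum>k<K. coord x k *\<^sub>C basis k) \<longlonglongrightarrow> x"
proof -
  let ?t = "\<lambda>K. \<Sum>k<K. coord x k *\<^sub>C basis k"
  have eq: "(norm (x - ?t K))\<^sup>2 = (norm x)\<^sup>2 - (\<Sum>k<K. (cmod (coord x k))\<^sup>2)" for K
  proof -
    have "(\<lambda>k. if k < K then (cmod (coord x k))\<^sup>2 else 0) sums (\<Sum>k<K. (cmod (coord x k))\<^sup>2)"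
      using sums_If_finite_set[OF finite_lessThan, of K "\<lambda>k. (cmod (coord x k))\<^sup>2"]
      by (simp only: lessThan_iff)
    then have "(\<lambda>k. (cmod (coord x k))\<^sup>2 - (if k < K then (cmod (coord x k))\<^sup>2 else 0)) sums
        ((norm x)\<^sup>2 - (\<Sum>k<K. (cmod (coord x k))\<^sup>2))"
      by (rule sums_diff[OF norm_sums])
    moreover have "(\<lambda>k. (cmod (coord x k))\<^sup>2 - (if k < K then (cmod (coord x k))\<^sup>2 else 0))
        = (\<lambda>k. (cmod (coord (x - ?t K) k))\<^sup>2)"
      unfolding basis_trunc minus_ell2.rep_eq by (rule ext) simp
    ultimately have "(\<lambda>k. (cmod (coord (x - ?t K) k))\<^sup>2) sums
        ((norm x)\<^sup>2 - (\<Sum>k<K. (cmod (coord x k))\<^sup>2))" by (simp only:)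
    then show ?thesis by (rule sums_unique2[OF norm_sums])
  qed
  have "(\<lambda>K. (norm x)\<^sup>2 - (\<Sum>k<K. (cmod (coord x k))\<^sup>2)) \<longlonglongrightarrow> (norm x)\<^sup>2 - (norm x)\<^sup>2"
    using norm_sums[of x] unfolding sums_def by (rule tendsto_diff[OF tendsto_const])
  then have "(\<lambda>K. sqrt ((norm (x - ?t K))\<^sup>2)) \<longlonglongrightarrow> sqrt 0"
    unfolding eq diff_self by (rule tendsto_real_sqrt)
  then have "(\<lambda>K. x - ?t K) \<longlonglongrightarrow> 0"
    by (simp only: real_sqrt_abs abs_norm_cancel real_sqrt_zero tendsto_norm_zero_iff)
  then have "(\<lambda>K. x - (x - ?t K)) \<longlonglongrightarrow> x - 0" by (rule tendsto_diff[OF tendsto_const])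
  then show ?thesis by (simp only: diff_diff_eq2 add_diff_cancel_left' diff_zero)
qed

lemma cinner_basis: "cinner x (basis k) = coord x k"
proof -
  have "(\<lambda>n. coord x n * cnj (coord (basis k) n)) = (\<lambda>n. if n = k then coord x n else 0)"
    by (auto simp: basis.rep_eq)
  then have "(\<lambda>n. if n = k then coord x n else 0) sums cinner x (basis k)"
    using cinner_sums[of x "basis k"] by (simp only:)
  then show ?thesis by (rule sums_unique2[OF _ sums_single])
qed

lemma bounded_linear_cinner_right: "bounded_linear (cinner x)"
proof (rule bounded_linear_intro[of _ "norm x"])
  show "cinner x (y + z) = cinner x y + cinner x z" for y z by (rule cinner_add_right)
  show "cinner x (r *\<^sub>R y) = r *\<^sub>R cinner x y" for r y
    unfolding scaleR_scaleC cinner_scaleC_right scaleR_conv_of_real by simp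
  show "cmod (cinner x y) \<le> norm y * norm x" for y
    using norm_cinner_le[of x y] by (simp only: mult.commute)
qed

lemma cinner_sum_right: "cinner x (sum f A) = (\<Sum>a\<in>A. cinner x (f a))"
  by (rule linear_sum[OF bounded_linear.linear[OF bounded_linear_cinner_right]])

lemma adjoint_exists:
  assumes T: "T \<in> bounded_ops"
  shows "\<exists>S :: ell2 \<Rightarrow>\<^sub>L ell2. S \<in> bounded_ops \<and> (\<forall>x y. cinner (S x) y = cinner x (T y))"
proof -
  have lin: "cinner y (T (\<Sum>k<K. f k *\<^sub>C basis k)) = (\<Sum>k<K. cnj (f k) * cinner y (T (basis k)))" for y f K
    using T by (simp add: blinfun.sum_right bounded_ops_def cinner_sum_right cinner_scaleC_right)
  have "\<exists>z. coord z = (\<lambda>k. cinner y (T (basis k))) \<and> norm z \<le> norm y * norm T" for y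
  proof -
    have "(\<Sum>k<K. (cmod (cinner y (T (basis k))))\<^sup>2) \<le> (norm y * norm T)\<^sup>2" for K
    proof -
      define s where "s = (\<Sum>k<K. (cmod (cinner y (T (basis k))))\<^sup>2)"
      define v where "v = (\<Sum>k<K. cinner y (T (basis k)) *\<^sub>C basis k)"
      have "(\<lambda>n. (cmod (coord v n))\<^sup>2) = (\<lambda>n. if n \<in> {..<K} then (cmod (cinner y (T (basis n))))\<^sup>2 else 0)"
        unfolding v_def basis_trunc by auto
      then have nv: "(norm v)\<^sup>2 = s"
        using sums_unique2[OF norm_sums[of v]] sums_If_finite_set[of "{..<K}" "\<lambda>n. (cmod (cinner y (T (basis n))))\<^sup>2"]
        by (simp add: s_def)
      have "complex_of_real s = cinner y (T v)"
        unfolding v_def lin s_def of_real_sum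
        by (intro sum.cong refl) (simp add: mult.commute flip: complex_norm_square)
      then have "s = cmod (cinner y (T v))"
        using nv by (metis abs_of_nonneg norm_of_real zero_le_power2)
      also have "\<dots> \<le> norm y * norm (T v)" by (rule norm_cinner_le)
      also have "\<dots> \<le> norm y * (norm T * norm v)" by (intro mult_left_mono norm_blinfun) simp
      finally have "norm v * norm v \<le> (norm y * norm T) * norm v"
        by (simp add: power2_eq_square ac_simps flip: nv)
      then have "norm v \<le> norm y * norm T"
        by (cases "norm v = 0") (auto simp: mult_le_cancel_right)
      then have "(norm v)\<^sup>2 \<le> (norm y * norm T)\<^sup>2" by (intro power_mono) auto
      then show ?thesis by (simp add: nv s_def)
    qed
    then obtain z where "coord z = (\<lambda>k. cinner y (T (basis k)))" "norm z \<le> norm y * norm T"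
      by (rule ell2_of_partial_sums) auto
    then show ?thesis by blast
  qed
  then have "\<exists>S. \<forall>y. coord (S y) = (\<lambda>k. cinner y (T (basis k))) \<and> norm (S y) \<le> norm y * norm T"
    by (intro choice) blast
  then obtain S where S: "\<And>y. coord (S y) = (\<lambda>k. cinner y (T (basis k)))"
    "\<And>y. norm (S y) \<le> norm y * norm T" by blast
  have "bounded_linear S"
    by (rule bounded_linear_intro[of _ "norm T"])
      (auto intro!: ell2_eqI simp: S cinner_add_left scaleR_scaleC cinner_scaleC_left)
  then have BS: "blinfun_apply (Blinfun S) = S" by (rule bounded_linear_Blinfun_apply)
  have "cinner (S x) y = cinner x (T y)" for x y
  proof -
    let ?t = "\<lambda>K. \<Sum>k<K. coord y k *\<^sub>C basis k"
    have 1: "(\<lambda>K. cinner (S x) (?t K)) \<longlonglongrightarrow> cinner (S x) y"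
      by (rule bounded_linear.tendsto[OF bounded_linear_cinner_right trunc_tendsto])
    have 2: "(\<lambda>K. cinner (S x) (?t K)) = (\<lambda>K. cinner x (T (?t K)))"
      unfolding lin cinner_sum_right cinner_scaleC_right cinner_basis S ..
    have 3: "(\<lambda>K. cinner x (T (?t K))) \<longlonglongrightarrow> cinner x (T y)"
      by (rule bounded_linear.tendsto[OF bounded_linear_cinner_right
            bounded_linear.tendsto[OF blinfun.bounded_linear_right trunc_tendsto]])
    show ?thesis by (rule LIMSEQ_unique[OF 1 3[folded 2]])
  qed
  moreover have "Blinfun S \<in> bounded_ops"
    by (auto intro!: ell2_eqI simp: bounded_ops_def BS S cinner_scaleC_left)
  ultimately show ?thesis by (intro exI[of _ "Blinfun S"]) (simp add: BS)
qed

lemma adj_eqI: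
  fixes S T :: "ell2 \<Rightarrow>\<^sub>L ell2"
  assumes "\<And>x y. cinner (S x) y = cinner x (T y)"
  shows "adj T = S"
  unfolding adj_def
proof (rule the_equality)
  fix R :: "ell2 \<Rightarrow>\<^sub>L ell2"
  assume "\<forall>x y. cinner (R x) y = cinner x (T y)"
  with assms have "R x = S x" for x by (intro cinner_eqI) simp
  then show "R = S" by (rule blinfun_eqI)
qed (simp add: assms)

lemma adj_props:
  assumes "T \<in> bounded_ops"
  shows "adj T \<in> bounded_ops" and "cinner (adj T x) y = cinner x (T y)"
proof -
  obtain S :: "ell2 \<Rightarrow>\<^sub>L ell2"
    where S: "S \<in> bounded_ops" "\<And>x y. cinner (S x) y = cinner x (T y)"
    using adjoint_exists[OF assms] by blast
  then have "adj T = S" by (intro adj_eqI)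
  then show "adj T \<in> bounded_ops" and "cinner (adj T x) y = cinner x (T y)" using S by auto
qed

definition star_subalgebra :: "(ell2 \<Rightarrow>\<^sub>L ell2) set \<Rightarrow> bool" where
  "star_subalgebra S \<longleftrightarrow>
     S \<subseteq> bounded_ops \<and> 0 \<in> S \<and>
     (\<forall>a\<in>S. \<forall>b\<in>S. a + b \<in> S) \<and> (\<forall>c. \<forall>a\<in>S. c \<cdot>\<^sub>C a \<in> S) \<and>
     (\<forall>a\<in>S. \<forall>b\<in>S. a o\<^sub>L b \<in> S) \<and> (\<forall>a\<in>S. adj a \<in> S)"

definition cstar_subalgebra :: "(ell2 \<Rightarrow>\<^sub>L ell2) set \<Rightarrow> bool" where
  "cstar_subalgebra S \<longleftrightarrow> star_subalgebra S \<and> closed S"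


section \<open>Supernatural numbers\<close>

text \<open>A supernatural number is represented by its exponents; only the values of \<open>N\<close> at primes
  are ever used.\<close>

type_synonym supernatural = "nat \<Rightarrow> enat"

definition supernatural_finite :: "supernatural \<Rightarrow> bool" where
  "supernatural_finite N \<longleftrightarrow> (\<Sum>\<^sub>\<infinity>p\<in>{p. prime p}. N p) < \<infinity>"

definition supernatural_dvd :: "nat \<Rightarrow> supernatural \<Rightarrow> bool" where
  "supernatural_dvd j N \<longleftrightarrow> 0 < j \<and> (\<forall>p. prime p \<longrightarrow> enat (multiplicity p j) \<le> N p)"


lemma supernatural_finite_iff:
  "supernatural_finite N \<longleftrightarrow> (\<forall>p. prime p \<longrightarrow> N p \<noteq> \<infinity>) \<and> finite {p. prime p \<and> N p \<noteq> 0}"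
proof
  let ?P = "{p::nat. prime p}"
  assume fin: "supernatural_finite N"
  have ub: "sum N F \<le> infsum N ?P" if "finite F" "F \<subseteq> ?P" for F
    unfolding nonneg_infsum_complete[of ?P N, OF zero_le]
    by (rule SUP_upper) (use that in auto)
  obtain n where n: "infsum N ?P = enat n"
    using fin unfolding supernatural_finite_def by auto
  have "N p \<noteq> \<infinity>" if "prime p" for p
    using ub[of "{p}"] that n by (cases "N p") auto
  moreover have "finite {p. prime p \<and> N p \<noteq> 0}"
  proof (rule ccontr)
    assume "infinite {p. prime p \<and> N p \<noteq> 0}"
    then obtain F where F: "F \<subseteq> {p. prime p \<and> N p \<noteq> 0}" "card F = Suc n" "finite F"
      using infinite_arbitrarily_large by blast
    have "(\<Sum>p\<in>F. 1) \<le> sum N F"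
      using F by (intro sum_mono) (auto simp: one_eSuc ileI1 zero_enat_def[symmetric] simp flip: eSuc_enat)
    also have "\<dots> \<le> enat n" using ub[of F] F n by auto
    finally show False using F by (simp add: of_nat_eq_enat)
  qed
  ultimately show "(\<forall>p. prime p \<longrightarrow> N p \<noteq> \<infinity>) \<and> finite {p. prime p \<and> N p \<noteq> 0}" by blast
next
  assume *: "(\<forall>p. prime p \<longrightarrow> N p \<noteq> \<infinity>) \<and> finite {p. prime p \<and> N p \<noteq> 0}"
  have "infsum N {p. prime p} = infsum N {p. prime p \<and> N p \<noteq> 0}"
    by (rule infsum_cong_neutral) auto
  also have "\<dots> = sum N {p. prime p \<and> N p \<noteq> 0}" using * by simp
  also have "\<dots> < \<infinity>"
  proof -
    have "sum N F \<noteq> \<infinity>" if "finite F" "\<forall>p\<in>F. N p \<noteq> \<infinity>" for F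
      using that by (induction F) auto
    then show ?thesis using * by auto
  qed
  finally show "supernatural_finite N" unfolding supernatural_finite_def .
qed

section \<open>The Bunce--Deddens--Toeplitz algebra\<close>

lift_definition shift_fun :: "ell2 \<Rightarrow> ell2" is "\<lambda>x k. case k of 0 \<Rightarrow> 0 | Suc n \<Rightarrow> x n"
  by (subst summable_Suc_iff[symmetric]) simp

lemma bounded_linear_shift_fun: "bounded_linear shift_fun"
proof (rule bounded_linear_intro[of _ 1])
  fix x y :: ell2 and r :: real
  show "shift_fun (x + y) = shift_fun x + shift_fun y"
    by (rule ell2_eqI) (simp add: shift_fun.rep_eq split: nat.split)
  show "shift_fun (r *\<^sub>R x) = r *\<^sub>R shift_fun x"
    by (rule ell2_eqI) (simp add: shift_fun.rep_eq split: nat.split)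
  have "(\<lambda>k. (cmod (coord (shift_fun x) k))\<^sup>2) sums (norm x)\<^sup>2"
    using norm_sums[of x] sums_Suc_iff[of "\<lambda>k. (cmod (coord (shift_fun x) k))\<^sup>2" "(norm x)\<^sup>2"]
    by (simp add: shift_fun.rep_eq)
  then have "(norm (shift_fun x))\<^sup>2 = (norm x)\<^sup>2" using sums_unique2 norm_sums by metis
  then show "norm (shift_fun x) \<le> norm x * 1" by (auto intro: power2_le_imp_le)
qed

definition shift :: "ell2 \<Rightarrow>\<^sub>L ell2" where
  "shift = Blinfun shift_fun"

lemma shift_apply [simp]: "shift x = shift_fun x"
  unfolding shift_def by (simp add: bounded_linear_Blinfun_apply bounded_linear_shift_fun)

lemma shift_basis: "shift (basis k) = basis (Suc k)"
  by (rule ell2_eqI) (simp add: shift_fun.rep_eq basis.rep_eq split: nat.split)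

lemma shift_in_bounded_ops: "shift \<in> bounded_ops"
  by (auto intro!: ell2_eqI simp: bounded_ops_def shift_fun.rep_eq split: nat.split)

text \<open>The operator \<open>a(\<K>)\<close>, meaningful for bounded \<open>a\<close>.\<close>

definition diag_op :: "(nat \<Rightarrow> complex) \<Rightarrow> (ell2 \<Rightarrow>\<^sub>L ell2)" where
  "diag_op a = Blinfun (\<lambda>x. Abs_ell2 (\<lambda>k. a k * coord x k))"

lemma coord_diag_op:
  assumes "\<And>k. cmod (a k) \<le> B"
  shows "coord (diag_op a x) k = a k * coord x k"
proof -
  define D where "D x = Abs_ell2 (\<lambda>k. a k * coord x k)" for x
  have B: "0 \<le> B" using assms[of 0] norm_ge_zero order_trans by blast
  have le: "(cmod (a k * coord x k))\<^sup>2 \<le> B\<^sup>2 * (cmod (coord x k))\<^sup>2" for x k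
    using assms[of k] by (simp add: norm_mult power_mult_distrib mult_right_mono power_mono)
  have "summable (\<lambda>k. (cmod (a k * coord x k))\<^sup>2)" for x
    using le by (intro summable_comparison_test'[OF summable_mult[OF summable_coord, of "B\<^sup>2"]]) simp
  then have c: "coord (D x) k = a k * coord x k" for x k by (simp add: D_def Abs_ell2_inverse)
  have "bounded_linear D"
  proof (rule bounded_linear_intro[of _ B])
    show "D (x + y) = D x + D y" "D (r *\<^sub>R x) = r *\<^sub>R D x" for x y r
      by (rule ell2_eqI, simp add: c algebra_simps)+
    have "(norm (D x))\<^sup>2 \<le> B\<^sup>2 * (norm x)\<^sup>2" for x
      by (rule sums_le[OF _ norm_sums sums_mult[OF norm_sums]]) (simp only: c le)
    then show "norm (D x) \<le> norm x * B" for x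
      using B by (intro power2_le_imp_le[of "norm (D x)" "norm x * B"])
        (simp_all add: power_mult_distrib mult.commute)
  qed
  then have "diag_op a x = D x"
    using bounded_linear_Blinfun_apply[of D] by (simp add: diag_op_def D_def[abs_def])
  then show ?thesis using c by simp
qed

definition diag_per :: "supernatural \<Rightarrow> (ell2 \<Rightarrow>\<^sub>L ell2) set" where
  "diag_per N = {diag_op a | a. \<exists>j. supernatural_dvd j N \<and> (\<forall>k. a (k + j) = a k)}"

lemma periodic_bounded:
  fixes a :: "nat \<Rightarrow> complex"
  assumes "0 < j" "\<forall>k. a (k + j) = a k"
  shows "\<exists>B. \<forall>k. cmod (a k) \<le> B"
proof (intro exI allI)
  fix k
  have "a (i + n * j) = a i" for i n
  proof (induction n)
    case (Suc n)
    have "i + Suc n * j = (i + n * j) + j" by simp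
    then have "a (i + Suc n * j) = a (i + n * j)" by (simp only: assms(2))
    then show ?case by (simp only: Suc.IH)
  qed simp
  from this[of "k mod j" "k div j"] have "a k = a (k mod j)" by (simp only: mod_div_mult_eq)
  moreover have "cmod (a (k mod j)) \<le> (\<Sum>i<j. cmod (a i))"
    using assms(1) by (intro member_le_sum) simp_all
  ultimately show "cmod (a k) \<le> (\<Sum>i<j. cmod (a i))" by (simp only:)
qed

lemma adj_adj: "T \<in> bounded_ops \<Longrightarrow> adj (adj T) = T"
  by (rule adj_eqI) (metis adj_props(2) cinner_commute)

lemma adj_zero: "adj 0 = 0"
  by (rule adj_eqI) simp

lemma adj_add: "S \<in> bounded_ops \<Longrightarrow> T \<in> bounded_ops \<Longrightarrow> adj (S + T) = adj S + adj T"
  by (rule adj_eqI) (simp add: blinfun.add_left cinner_add_left cinner_add_right adj_props(2))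

lemma adj_scaleC: "T \<in> bounded_ops \<Longrightarrow> adj (c \<cdot>\<^sub>C T) = cnj c \<cdot>\<^sub>C adj T"
  by (rule adj_eqI) (simp add: cinner_scaleC_left cinner_scaleC_right adj_props(2))

lemma adj_compose: "S \<in> bounded_ops \<Longrightarrow> T \<in> bounded_ops \<Longrightarrow> adj (S o\<^sub>L T) = adj T o\<^sub>L adj S"
  by (rule adj_eqI) (simp add: adj_props(2))

lemma star_subalgebra_bounded_ops: "star_subalgebra bounded_ops"
  unfolding star_subalgebra_def
  by (auto simp: adj_props(1))
    (auto simp: bounded_ops_def blinfun.add_left ell2.scale_right_distrib ac_simps)

lemma coord_adj_shift: "coord (adj shift x) k = coord x (Suc k)"
  by (simp only: adj_props(2)[OF shift_in_bounded_ops] shift_basis flip: cinner_basis)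

lemma diag_op_in_bounded_ops:
  assumes "\<And>k. cmod (a k) \<le> B"
  shows "diag_op a \<in> bounded_ops"
  unfolding bounded_ops_def using coord_diag_op[OF assms] by (auto intro!: ell2_eqI)

lemma diag_per_E:
  assumes "T \<in> diag_per N"
  obtains a B where "T = diag_op a" "\<And>k. cmod (a k) \<le> B"
  using assms unfolding diag_per_def supernatural_dvd_def by (blast dest: periodic_bounded)

lemma diag_per_subset: "diag_per N \<subseteq> bounded_ops"
  by (auto elim!: diag_per_E intro: diag_op_in_bounded_ops)

lemma adj_diag_op:
  assumes "\<And>k. cmod (a k) \<le> B"
  shows "adj (diag_op a) = diag_op (\<lambda>k. cnj (a k))"
proof (rule adj_eqI)
  have "\<And>k. cmod (cnj (a k)) \<le> B" using assms by simp
  note c = coord_diag_op[OF this] coord_diag_op[OF assms]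
  show "cinner (diag_op (\<lambda>k. cnj (a k)) x) y = cinner x (diag_op a y)" for x y
    by (simp add: cinner.rep_eq c ac_simps)
qed

text \<open>\<open>BDT N\<close> is the C*-algebra \<open>A(N)\<close>, and \<open>BDT_alg N\<close> its dense *-subalgebra.\<close>

definition BDT :: "supernatural \<Rightarrow> (ell2 \<Rightarrow>\<^sub>L ell2) set" where
  "BDT N = cstar_subalgebra hull (insert shift (diag_per N))"

definition BDT_alg :: "supernatural \<Rightarrow> (ell2 \<Rightarrow>\<^sub>L ell2) set" where
  "BDT_alg N = star_subalgebra hull ({shift, adj shift} \<union> diag_per N)"


section \<open>Derivations\<close>

definition derivation :: "supernatural \<Rightarrow> ((ell2 \<Rightarrow>\<^sub>L ell2) \<Rightarrow> (ell2 \<Rightarrow>\<^sub>L ell2)) \<Rightarrow> bool" where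
  "derivation N d \<longleftrightarrow>
     (\<forall>a\<in>BDT_alg N. d a \<in> BDT N) \<and>
     (\<forall>a\<in>BDT_alg N. \<forall>b\<in>BDT_alg N. d (a + b) = d a + d b) \<and>
     (\<forall>c. \<forall>a\<in>BDT_alg N. d (c \<cdot>\<^sub>C a) = c \<cdot>\<^sub>C d a) \<and>
     (\<forall>a\<in>BDT_alg N. \<forall>b\<in>BDT_alg N. d (a o\<^sub>L b) = (d a o\<^sub>L b) + (a o\<^sub>L d b))"

definition approximately_inner :: "supernatural \<Rightarrow> ((ell2 \<Rightarrow>\<^sub>L ell2) \<Rightarrow> (ell2 \<Rightarrow>\<^sub>L ell2)) \<Rightarrow> bool" where
  "approximately_inner N d \<longleftrightarrow>
     (\<exists>s :: nat \<Rightarrow> ell2 \<Rightarrow>\<^sub>L ell2. (\<forall>n. s n \<in> BDT N) \<and>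
        (\<forall>a\<in>BDT_alg N. (\<lambda>n. commutator (s n) a) \<longlonglongrightarrow> d a))"

text \<open>The unbounded operator \<open>\<K>\<close> with \<open>\<K> E\<^sub>k = k E\<^sub>k\<close>, meaningful on its maximal domain; it is
  only applied to vectors in the linear span of the canonical basis.\<close>

definition number_op :: "ell2 \<Rightarrow> ell2" where
  "number_op x = Abs_ell2 (\<lambda>k. of_nat k * coord x k)"

text \<open>The bounded extension of \<open>[\<K>, a]\<close>, computed on the linear span of the canonical basis.\<close>

definition number_commutator :: "(ell2 \<Rightarrow>\<^sub>L ell2) \<Rightarrow> (ell2 \<Rightarrow>\<^sub>L ell2)" where
  "number_commutator a =
     (THE T :: ell2 \<Rightarrow>\<^sub>L ell2. \<forall>x\<in>ell2.span (range basis). T x = number_op (a x) - a (number_op x))"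

subsection \<open>The commutator with the number operator is well-defined\<close>

abbreviation finite_span :: "ell2 set" where
  "finite_span \<equiv> ell2.span (range basis)"

lemma basis_in_span: "basis k \<in> finite_span"
  by (rule ell2.span_base) simp

lemma finite_span_support: "x \<in> finite_span \<Longrightarrow> finite {k. coord x k \<noteq> 0}"
proof (induction rule: ell2.span_induct_alt)
  case base
  then show ?case by simp
next
  case (step c x y)
  then obtain n where "x = basis n" by blast
  then have "{k. coord (c *\<^sub>C x + y) k \<noteq> 0} \<subseteq> insert n {k. coord y k \<noteq> 0}"
    by (auto simp: basis.rep_eq split: if_splits)
  then show ?case using step by (meson finite.insertI finite_subset)
qed

lemma coord_number_op:
  assumes "x \<in> finite_span"
  shows "coord (number_op x) k = of_nat k * coord x k"
proof -
  have "summable (\<lambda>k. (cmod (of_nat k * coord x k))\<^sup>2)"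
    by (rule summable_finite[OF finite_span_support[OF assms]]) auto
  then show ?thesis by (simp add: number_op_def Abs_ell2_inverse)
qed

lemma number_op_basis: "number_op (basis k) = of_nat k *\<^sub>C basis k"
  by (rule ell2_eqI) (simp add: coord_number_op basis_in_span basis.rep_eq)

lemma number_op_lin:
  assumes "x \<in> finite_span" "y \<in> finite_span"
  shows "number_op (c *\<^sub>C x + y) = c *\<^sub>C number_op x + number_op y"
  using assms by (intro ell2_eqI)
    (simp add: coord_number_op ell2.span_add ell2.span_scale distrib_left)

lemma number_op_zero: "number_op 0 = 0"
  by (rule ell2_eqI) (simp add: coord_number_op ell2.span_zero)

lemma number_op_add:
  "x \<in> finite_span \<Longrightarrow> y \<in> finite_span \<Longrightarrow> number_op (x + y) = number_op x + number_op y"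
  using number_op_lin[of x y 1] by simp

lemma number_op_scale: "x \<in> finite_span \<Longrightarrow> number_op (c *\<^sub>C x) = c *\<^sub>C number_op x"
  using number_op_lin[of x 0 c] by (simp add: ell2.span_zero number_op_zero)

lemma number_op_in_span:
  assumes "x \<in> finite_span"
  shows "number_op x \<in> finite_span"
proof -
  have "number_op x \<in> finite_span \<and> x \<in> finite_span"
    using assms
  proof (induction rule: ell2.span_induct_alt)
    case base
    then show ?case by (simp add: number_op_zero ell2.span_zero)
  next
    case (step c x y)
    then obtain n where x: "x = basis n" by blast
    from step have y: "number_op y \<in> finite_span" "y \<in> finite_span" by blast+
    have "number_op (c *\<^sub>C x + y) = c *\<^sub>C of_nat n *\<^sub>C basis n + number_op y"
      unfolding x by (simp only: number_op_lin[OF basis_in_span y(2)] number_op_basis)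
    then show ?case using y by (simp only: x ell2.span_add ell2.span_scale basis_in_span)
  qed
  then show ?thesis ..
qed

lemma cinner_number_op:
  "x \<in> finite_span \<Longrightarrow> y \<in> finite_span \<Longrightarrow> cinner (number_op x) y = cinner x (number_op y)"
  by (simp add: cinner.rep_eq coord_number_op ac_simps)

definition preserves_span :: "(ell2 \<Rightarrow>\<^sub>L ell2) \<Rightarrow> bool" where
  "preserves_span T \<longleftrightarrow> (\<forall>x\<in>finite_span. T x \<in> finite_span)"

definition has_number_commutator :: "(ell2 \<Rightarrow>\<^sub>L ell2) \<Rightarrow> (ell2 \<Rightarrow>\<^sub>L ell2) \<Rightarrow> bool" where
  "has_number_commutator a T \<longleftrightarrow>
     (\<forall>x\<in>finite_span. T x = number_op (a x) - a (number_op x))"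

lemma op_lin: "T \<in> bounded_ops \<Longrightarrow> T (c *\<^sub>C x + y) = c *\<^sub>C T x + T y"
  by (simp add: bounded_ops_def blinfun.add_right)

lemma op_scale: "T \<in> bounded_ops \<Longrightarrow> T (c *\<^sub>C x) = c *\<^sub>C T x"
  by (simp add: bounded_ops_def)

lemma preserves_spanI:
  assumes "T \<in> bounded_ops" "\<And>k. T (basis k) \<in> finite_span"
  shows "preserves_span T"
  unfolding preserves_span_def
proof
  fix x assume "x \<in> finite_span"
  then show "T x \<in> finite_span"
  proof (induction rule: ell2.span_induct_alt)
    case base
    then show ?case by (simp add: blinfun.zero_right ell2.span_zero)
  next
    case (step c x y)
    then have "T x \<in> finite_span" using assms(2) by blast
    with step show ?case by (simp only: op_lin[OF assms(1)] ell2.span_add ell2.span_scale)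
  qed
qed

lemma has_number_commutatorI:
  assumes "a \<in> bounded_ops" "T \<in> bounded_ops" "preserves_span a"
    and "\<And>k. T (basis k) = number_op (a (basis k)) - of_nat k *\<^sub>C a (basis k)"
  shows "has_number_commutator a T"
  unfolding has_number_commutator_def
proof
  fix x assume "x \<in> finite_span"
  then have "T x = number_op (a x) - a (number_op x) \<and> x \<in> finite_span"
  proof (induction rule: ell2.span_induct_alt)
    case base
    then show ?case by (simp add: blinfun.zero_right number_op_zero ell2.span_zero)
  next
    case (step c x y)
    then obtain n where x: "x = basis n" by blast
    have a: "a x \<in> finite_span" "a y \<in> finite_span" "x \<in> finite_span" "y \<in> finite_span"
      using step assms(3) by (auto simp: preserves_span_def x basis_in_span)
    have "T x = number_op (a x) - a (number_op x)"
      unfolding x assms(4) number_op_basis op_scale[OF assms(1)] ..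
    then have "T (c *\<^sub>C x + y) = c *\<^sub>C (number_op (a x) - a (number_op x)) +
        (number_op (a y) - a (number_op y))"
      using step by (simp add: op_lin[OF assms(2)])
    also have "\<dots> = number_op (a (c *\<^sub>C x + y)) - a (number_op (c *\<^sub>C x + y))"
      using a by (simp add: number_op_lin op_lin[OF assms(1)] ell2.scale_right_diff_distrib)
    finally show ?case using a by (simp only: ell2.span_add ell2.span_scale)
  qed
  then show "T x = number_op (a x) - a (number_op x)" by blast
qed

lemma has_number_commutator_unique:
  assumes "has_number_commutator a T"
  shows "number_commutator a = T"
proof -
  have "R = T" if "has_number_commutator a R" for R
  proof (rule blinfun_eqI)
    fix x
    let ?t = "\<lambda>K. \<Sum>k<K. coord x k *\<^sub>C basis k"
    have t: "?t K \<in> finite_span" for K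
      by (intro ell2.span_sum ell2.span_scale basis_in_span)
    have "R (?t K) = T (?t K)" for K
      using that assms t[of K] unfolding has_number_commutator_def by metis
    then have eq: "(\<lambda>K. R (?t K)) = (\<lambda>K. T (?t K))" by blast
    have "(\<lambda>K. R (?t K)) \<longlonglongrightarrow> R x" "(\<lambda>K. T (?t K)) \<longlonglongrightarrow> T x"
      by (rule bounded_linear.tendsto[OF blinfun.bounded_linear_right trunc_tendsto])+
    then show "R x = T x" unfolding eq by (rule LIMSEQ_unique)
  qed
  then show ?thesis
    unfolding number_commutator_def using assms unfolding has_number_commutator_def
    by (intro the_equality) blast+
qed

lemma star_subalgebra_BDT_alg: "star_subalgebra (BDT_alg N)"
proof -
  have "BDT_alg N \<subseteq> bounded_ops"
    unfolding BDT_alg_def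
    using star_subalgebra_bounded_ops shift_in_bounded_ops adj_props(1) diag_per_subset
    by (intro hull_minimal) auto
  then show ?thesis
    unfolding BDT_alg_def hull_def star_subalgebra_def by blast
qed

theorem number_commutator_BDT_alg:
  assumes "a \<in> BDT_alg N"
  shows "has_number_commutator a (number_commutator a)"
    and "number_commutator a \<in> BDT_alg N"
proof -
  let ?A = "BDT_alg N"
  define G where "G = {a \<in> ?A. preserves_span a \<and> preserves_span (adj a) \<and>
    (\<exists>T\<in>?A. has_number_commutator a T)}"
  have A: "?A \<subseteq> bounded_ops" "0 \<in> ?A"
    "\<And>a b. a \<in> ?A \<Longrightarrow> b \<in> ?A \<Longrightarrow> a + b \<in> ?A" "\<And>c a. a \<in> ?A \<Longrightarrow> c \<cdot>\<^sub>C a \<in> ?A"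
    "\<And>a b. a \<in> ?A \<Longrightarrow> b \<in> ?A \<Longrightarrow> a o\<^sub>L b \<in> ?A" "\<And>a. a \<in> ?A \<Longrightarrow> adj a \<in> ?A"
    using star_subalgebra_BDT_alg[of N] unfolding star_subalgebra_def by blast+
  have gen: "{shift, adj shift} \<union> diag_per N \<subseteq> ?A"
    unfolding BDT_alg_def by (rule hull_subset)
  have sum: "a + b \<in> G" if "a \<in> G" "b \<in> G" for a b
  proof -
    obtain S T where ST: "S \<in> ?A" "T \<in> ?A" "has_number_commutator a S" "has_number_commutator b T"
      using \<open>a \<in> G\<close> \<open>b \<in> G\<close> unfolding G_def by blast
    have ab: "a \<in> ?A" "b \<in> ?A" "a \<in> bounded_ops" "b \<in> bounded_ops" using that A(1) by (auto simp: G_def)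
    have "has_number_commutator (a + b) (S + T)"
      using ST(3,4) that
      by (auto simp: has_number_commutator_def blinfun.add_left G_def preserves_span_def number_op_add)
    moreover have "preserves_span (a + b)" "preserves_span (adj (a + b))"
      using that by (auto simp: G_def preserves_span_def adj_add ab blinfun.add_left ell2.span_add)
    ultimately show ?thesis using A(3) ab ST unfolding G_def by blast
  qed
  have scale: "c \<cdot>\<^sub>C a \<in> G" if "a \<in> G" for c a
  proof -
    obtain S where S: "S \<in> ?A" "has_number_commutator a S"
      using \<open>a \<in> G\<close> unfolding G_def by blast
    have a: "a \<in> ?A" "a \<in> bounded_ops" using that A(1) by (auto simp: G_def)
    have "has_number_commutator (c \<cdot>\<^sub>C a) (c \<cdot>\<^sub>C S)"
      using S that
      by (auto simp: has_number_commutator_def G_def preserves_span_def number_op_scale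
          ell2.scale_right_diff_distrib)
    moreover have "preserves_span (c \<cdot>\<^sub>C a)" "preserves_span (adj (c \<cdot>\<^sub>C a))"
      using that by (auto simp: G_def preserves_span_def adj_scaleC a ell2.span_scale)
    ultimately show ?thesis using A(4) a S unfolding G_def by blast
  qed
  have prod: "a o\<^sub>L b \<in> G" if "a \<in> G" "b \<in> G" for a b
  proof -
    obtain S T where ST: "S \<in> ?A" "T \<in> ?A" "has_number_commutator a S" "has_number_commutator b T"
      using \<open>a \<in> G\<close> \<open>b \<in> G\<close> unfolding G_def by blast
    have ab: "a \<in> ?A" "b \<in> ?A" "a \<in> bounded_ops" "b \<in> bounded_ops" using that A(1) by (auto simp: G_def)
    have "has_number_commutator (a o\<^sub>L b) ((S o\<^sub>L b) + (a o\<^sub>L T))"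
      using ST(3,4) that
      by (auto simp: has_number_commutator_def blinfun.add_left blinfun.diff_right G_def
          preserves_span_def)
    moreover have "preserves_span (a o\<^sub>L b)" "preserves_span (adj (a o\<^sub>L b))"
      using that by (auto simp: G_def preserves_span_def adj_compose ab)
    moreover have "(S o\<^sub>L b) + (a o\<^sub>L T) \<in> ?A" "a o\<^sub>L b \<in> ?A" using A(3,5) ab ST by blast+
    ultimately show ?thesis unfolding G_def by blast
  qed
  have star: "adj a \<in> G" if "a \<in> G" for a
  proof -
    obtain S where S: "S \<in> ?A" "has_number_commutator a S"
      using \<open>a \<in> G\<close> unfolding G_def by blast
    have a: "a \<in> ?A" "a \<in> bounded_ops" "S \<in> bounded_ops" using that A(1) S by (auto simp: G_def)
    have p: "preserves_span a" "preserves_span (adj a)" using that by (auto simp: G_def)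
    let ?T = "(-1) \<cdot>\<^sub>C adj S"
    have "?T x = number_op (adj a x) - adj a (number_op x)" if x: "x \<in> finite_span" for x
    proof (rule ell2_eqI)
      fix k
      have e: "basis k \<in> finite_span" by (rule basis_in_span)
      have "cinner (?T x) (basis k) = - cinner x (S (basis k))"
        
        unfolding scaleC_op_apply cinner_scaleC_left adj_props(2)[OF a(3)] by simp
      also have "\<dots> = - cinner x (number_op (a (basis k)) - a (number_op (basis k)))"
        using S(2) e unfolding has_number_commutator_def by metis
      also have "\<dots> = cinner x (a (number_op (basis k))) - cinner x (number_op (a (basis k)))"
        by (simp add: cinner_diff_right)
      also have "cinner x (number_op (a (basis k))) = cinner (number_op x) (a (basis k))"
        using p e x by (simp add: cinner_number_op preserves_span_def)
      also have "cinner x (a (number_op (basis k))) = cinner (number_op (adj a x)) (basis k)"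
        using p e x by (simp add: cinner_number_op preserves_span_def adj_props(2) a)
      also have "cinner (number_op x) (a (basis k)) = cinner (adj a (number_op x)) (basis k)"
        by (simp add: adj_props(2) a)
      finally show "coord (?T x) k = coord (number_op (adj a x) - adj a (number_op x)) k"
        by (simp only: cinner_diff_left flip: cinner_basis)
    qed
    then have "has_number_commutator (adj a) ?T" unfolding has_number_commutator_def by blast
    moreover have "?T \<in> ?A" "adj a \<in> ?A" using A(4,6) S a by blast+
    moreover have "preserves_span (adj (adj a))" using p adj_adj[OF a(2)] by simp
    ultimately show ?thesis using p unfolding G_def by blast
  qed
  have zero: "0 \<in> G"
    unfolding G_def
    by (auto simp: A preserves_span_def adj_zero ell2.span_zero has_number_commutator_def number_op_zero
        intro!: bexI[of _ 0])
  have "star_subalgebra G"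
    unfolding star_subalgebra_def using A(1) sum scale prod star zero by (auto simp: G_def)
  moreover have "shift \<in> G"
  proof -
    have 1: "preserves_span shift"
      by (rule preserves_spanI[OF shift_in_bounded_ops]) (simp only: shift_basis basis_in_span)
    have as: "adj shift (basis k) = (if k = 0 then 0 else basis (k - 1))" for k
      by (rule ell2_eqI) (auto simp: coord_adj_shift basis.rep_eq)
    have 2: "preserves_span (adj shift)"
      by (rule preserves_spanI[OF adj_props(1)[OF shift_in_bounded_ops]])
        (simp add: as ell2.span_zero basis_in_span)
    have "shift (basis k) = number_op (shift (basis k)) - of_nat k *\<^sub>C shift (basis k)" for k
      unfolding shift_basis number_op_basis by (rule ell2_eqI) (simp add: algebra_simps)
    then have "has_number_commutator shift shift"
      by (intro has_number_commutatorI shift_in_bounded_ops 1)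
    then show ?thesis using 1 2 gen unfolding G_def by blast
  qed
  moreover have "T \<in> G" if T: "T \<in> diag_per N" for T
  proof -
    obtain a B where a: "T = diag_op a" "\<And>k. cmod (a k) \<le> B" using T by (blast elim: diag_per_E)
    have pres: "preserves_span (diag_op b)" if b: "\<And>k. cmod (b k) \<le> B" for b
    proof (rule preserves_spanI[OF diag_op_in_bounded_ops[OF b]])
      fix k
      have "diag_op b (basis k) = b k *\<^sub>C basis k"
        by (rule ell2_eqI) (simp add: coord_diag_op[OF b] basis.rep_eq)
      then show "diag_op b (basis k) \<in> finite_span"
        by (simp only: ell2.span_scale basis_in_span)
    qed
    have 1: "preserves_span T" unfolding a(1) using a(2) by (rule pres)
    have 2: "preserves_span (adj T)" unfolding a(1) adj_diag_op[OF a(2)] using a(2) by (intro pres) simp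
    have Tb: "T (basis k) = a k *\<^sub>C basis k" for k
      by (rule ell2_eqI) (simp add: a(1) coord_diag_op[OF a(2)] basis.rep_eq)
    have "(0 :: ell2 \<Rightarrow>\<^sub>L ell2) (basis k) = number_op (T (basis k)) - of_nat k *\<^sub>C T (basis k)" for k
      unfolding Tb number_op_scale[OF basis_in_span] number_op_basis
      by (rule ell2_eqI) (simp add: algebra_simps)
    then have "has_number_commutator T 0"
      using T diag_per_subset A by (intro has_number_commutatorI 1) auto
    then show ?thesis using 1 2 gen T A(2) unfolding G_def by blast
  qed
  ultimately have "BDT_alg N \<subseteq> G"
    unfolding BDT_alg_def using star by (intro hull_minimal) auto
  then obtain T where "T \<in> ?A" "has_number_commutator a T" using assms unfolding G_def by blast
  then show "has_number_commutator a (number_commutator a)" and "number_commutator a \<in> ?A"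
    using has_number_commutator_unique by metis+
qed

end

theory Submission
  imports Defs "HOL-Number_Theory.Cong"
begin

text \<open>
  For \<open>j\<close> dividing \<open>N\<close> let \<open>p\<^sub>i\<close>, \<open>i < j\<close>, be the projections onto the residue classes modulo \<open>j\<close>,
  and put \<open>x = \<Sum>\<^sub>i d(p\<^sub>i) p\<^sub>i\<close>. Then \<open>d - [x, \<cdot>]\<close> vanishes on the \<open>j\<close>-periodic diagonal operators and sends
  \<open>U\<close> to \<open>\<Sum>\<^sub>i p\<^sub>i\<^sub>+\<^sub>1 d(U) p\<^sub>i\<close>, which keeps only the matrix entries of \<open>d(U)\<close> on the diagonals congruent
  to the first subdiagonal modulo \<open>j\<close>. As \<open>j\<close> grows along the divisors of the infinite number \<open>N\<close>, it
  converges in norm to the subdiagonal part \<open>U g(\<K>)\<close> of \<open>d(U)\<close>. The sequence \<open>g\<close> is a uniform limit of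
  eventually periodic sequences \<open>h\<close>, and \<open>h(k) = b(k + 1) - b(k) + c\<close> with \<open>b\<close> eventually periodic and
  \<open>c\<close> the mean of \<open>h\<close>; so \<open>U g(\<K>)\<close> is \<open>C U = C [\<K>, U]\<close> plus a limit of commutators \<open>[b(\<K>), U]\<close>,
  where \<open>C\<close> is the mean of \<open>g\<close>. An approximately inner derivation has mean \<open>0\<close>, so \<open>C\<close> is unique.
\<close>

section \<open>Matrix entries\<close>

lemma norm_basis [simp]: "norm (basis k) = 1"
proof -
  have "complex_of_real ((norm (basis k))\<^sup>2) = of_real 1"
    unfolding cinner_self[symmetric] cinner_basis by (simp add: basis.rep_eq)
  then have "(norm (basis k))\<^sup>2 = 1" by (simp only: of_real_eq_iff)
  then show ?thesis by (smt (verit) power2_eq_1_iff norm_ge_zero)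
qed

lemma bounded_ops_eqI:
  assumes "S \<in> bounded_ops" "T \<in> bounded_ops" "\<And>k. S (basis k) = T (basis k)"
  shows "S = T"
proof (rule blinfun_eqI)
  fix x
  let ?t = "\<lambda>K. \<Sum>k<K. coord x k *\<^sub>C basis k"
  have "S (?t K) = T (?t K)" for K
    by (simp add: blinfun.sum_right op_scale assms)
  then have eq: "(\<lambda>K. S (?t K)) = (\<lambda>K. T (?t K))" by blast
  have "(\<lambda>K. S (?t K)) \<longlonglongrightarrow> S x" "(\<lambda>K. T (?t K)) \<longlonglongrightarrow> T x"
    by (rule bounded_linear.tendsto[OF blinfun.bounded_linear_right trunc_tendsto])+
  then show "S x = T x" unfolding eq by (rule LIMSEQ_unique)
qed

definition entry :: "(ell2 \<Rightarrow>\<^sub>L ell2) \<Rightarrow> nat \<Rightarrow> nat \<Rightarrow> complex" where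
  "entry T k l = coord (T (basis l)) k"

lemma bounded_ops_entryI:
  assumes "S \<in> bounded_ops" "T \<in> bounded_ops" "\<And>k l. entry S k l = entry T k l"
  shows "S = T"
  using assms(3) by (intro bounded_ops_eqI assms(1,2) ell2_eqI) (simp add: entry_def)

lemma norm_entry_le: "cmod (entry T k l) \<le> norm T"
  using norm_coord_le[of "T (basis l)" k] norm_blinfun[of T "basis l"] by (simp add: entry_def)

lemma entry_simps [simp]:
  "entry 0 k l = 0"
  "entry (S + T) k l = entry S k l + entry T k l"
  "entry (S - T) k l = entry S k l - entry T k l"
  "entry (c \<cdot>\<^sub>C T) k l = c * entry T k l"
  by (simp_all add: entry_def blinfun.add_left blinfun.diff_left)

lemma entry_adj: "T \<in> bounded_ops \<Longrightarrow> entry (adj T) k l = cnj (entry T l k)"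
  by (metis entry_def cinner_basis adj_props(2) cinner_commute)

lemma entry_shift: "entry shift k l = (if k = Suc l then 1 else 0)"
  unfolding entry_def shift_basis by (simp add: basis.rep_eq)

lemma entry_diag_op:
  assumes "\<And>k. cmod (a k) \<le> B"
  shows "entry (diag_op a) k l = (if k = l then a k else 0)"
  unfolding entry_def coord_diag_op[OF assms] by (simp add: basis.rep_eq)

lemma shift_compose_entry:
  "entry (shift o\<^sub>L T) k l = (if k = 0 then 0 else entry T (k - 1) l)"
  "entry (T o\<^sub>L shift) k l = entry T k (Suc l)"
  unfolding entry_def by (simp_all add: shift_fun.rep_eq split: nat.split)
    (metis shift_apply shift_basis)

lemma adj_shift_basis: "adj shift (basis k) = (if k = 0 then 0 else basis (k - 1))"
  by (rule ell2_eqI) (auto simp: coord_adj_shift basis.rep_eq)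

lemma adj_shift_shift: "adj shift o\<^sub>L shift = id_blinfun"
  by (rule blinfun_eqI, rule ell2_eqI) (simp add: coord_adj_shift shift_fun.rep_eq)

section \<open>Norm bounds and norm-closed star subalgebras\<close>

lemma norm_shift_le: "norm shift \<le> 1"
proof (rule norm_blinfun_bound)
  fix x
  have "(\<lambda>k. (cmod (coord (shift x) k))\<^sup>2) sums (norm x)\<^sup>2"
    using norm_sums[of x] sums_Suc_iff[of "\<lambda>k. (cmod (coord (shift x) k))\<^sup>2" "(norm x)\<^sup>2"]
    by (simp add: shift_fun.rep_eq)
  then have "(norm (shift x))\<^sup>2 = (norm x)\<^sup>2" by (rule sums_unique2[OF norm_sums])
  then show "norm (shift x) \<le> 1 * norm x" by simp
qed simp

lemma norm_adj_le:
  assumes "T \<in> bounded_ops"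
  shows "norm (adj T) \<le> norm T"
proof (rule norm_blinfun_bound)
  fix x
  have "(norm (adj T x))\<^sup>2 = cmod (cinner (adj T x) (adj T x))"
    by (simp add: cinner_self norm_power)
  also have "\<dots> = cmod (cinner x (T (adj T x)))" using adj_props(2)[OF assms] by metis
  also have "\<dots> \<le> norm x * (norm T * norm (adj T x))"
    by (rule order_trans[OF norm_cinner_le mult_left_mono[OF norm_blinfun]]) simp
  finally show "norm (adj T x) \<le> norm T * norm x"
    by (cases "adj T x = 0") (simp_all add: power2_eq_square ac_simps)
qed simp

lemma norm_diag_op_le:
  assumes "\<And>k. cmod (a k) \<le> B"
  shows "norm (diag_op a) \<le> B"
proof (rule norm_blinfun_bound)
  show B: "0 \<le> B" using assms[of 0] norm_ge_zero order_trans by blast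
  fix x
  have "(norm (diag_op a x))\<^sup>2 \<le> B\<^sup>2 * (norm x)\<^sup>2"
    by (rule sums_le[OF _ norm_sums sums_mult[OF norm_sums]])
      (simp add: coord_diag_op[OF assms] norm_mult power_mult_distrib assms mult_right_mono power_mono)
  then show "norm (diag_op a x) \<le> B * norm x"
    using B by (intro power2_le_imp_le[of "norm (diag_op a x)" "B * norm x"]) (simp_all add: power_mult_distrib)
qed

lemma norm_scaleC_op_le: "norm (c \<cdot>\<^sub>C T) \<le> cmod c * norm T"
proof (rule norm_blinfun_bound)
  show "norm ((c \<cdot>\<^sub>C T) x) \<le> cmod c * norm T * norm x" for x
    using mult_left_mono[OF norm_blinfun[of T x], of "cmod c"] by (simp add: norm_scaleC ac_simps)
qed simp

text \<open>All the operations are norm continuous. Complex linearity survives limits, so every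
  limit has an adjoint, and adjunction is a contraction on \<open>bounded_ops\<close> by
  \<open>norm_adj_le\<close>.\<close>

lemma star_subalgebra_closure:
  assumes S: "star_subalgebra S"
  shows "star_subalgebra (closure S)"
proof -
  have sub: "S \<subseteq> bounded_ops" using S by (simp add: star_subalgebra_def)
  have scale: "(\<lambda>n. c \<cdot>\<^sub>C X n) \<longlonglongrightarrow> c \<cdot>\<^sub>C a" if "X \<longlonglongrightarrow> a" for c X a
  proof -
    have "bounded_linear (scaleC_op c)"
    proof (rule bounded_linear_intro[of _ "cmod c"])
      show "norm (c \<cdot>\<^sub>C T) \<le> norm T * cmod c" for T
        using norm_scaleC_op_le[of c T] by (simp only: mult.commute)
    qed (auto intro!: blinfun_eqI ell2_eqI simp: blinfun.add_left blinfun.scaleR_left algebra_simps)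
    then show ?thesis by (rule bounded_linear.tendsto[OF _ that])
  qed
  have closed: "a \<in> bounded_ops" if a: "a \<in> closure S" for a
  proof -
    obtain X where X: "\<And>n. X n \<in> S" "X \<longlonglongrightarrow> a" using a unfolding closure_sequential by blast
    have "a (c *\<^sub>C x) = c *\<^sub>C a x" for c x
    proof (rule LIMSEQ_unique)
      show "(\<lambda>n. X n (c *\<^sub>C x)) \<longlonglongrightarrow> a (c *\<^sub>C x)"
        by (rule bounded_linear.tendsto[OF blinfun.bounded_linear_left X(2)])
      have "(\<lambda>n. c *\<^sub>C X n x) \<longlonglongrightarrow> c *\<^sub>C a x"
        by (rule bounded_linear.tendsto[OF bounded_linear_scaleC
              bounded_linear.tendsto[OF blinfun.bounded_linear_left X(2)]])
      moreover have "X n (c *\<^sub>C x) = c *\<^sub>C X n x" for n using op_scale[of "X n"] X(1) sub by blast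
      ultimately show "(\<lambda>n. X n (c *\<^sub>C x)) \<longlonglongrightarrow> c *\<^sub>C a x" by simp
    qed
    then show ?thesis by (simp add: bounded_ops_def)
  qed
  have "adj a \<in> closure S" if a: "a \<in> closure S" for a
  proof -
    obtain X where X: "\<And>n. X n \<in> S" "X \<longlonglongrightarrow> a" using a unfolding closure_sequential by blast
    have b: "a \<in> bounded_ops" "X n \<in> bounded_ops" for n using a X(1) sub closed by auto
    have diff: "X n - a \<in> bounded_ops" for n
      using b by (auto simp: bounded_ops_def blinfun.diff_left ell2.scale_right_diff_distrib)
    have "norm (adj (X n) - adj a) \<le> norm (X n - a)" for n
    proof -
      have "adj (X n - a) = adj (X n) - adj a"
        using adj_add[OF diff b(1), of n] by (simp add: algebra_simps)
      then show ?thesis using norm_adj_le[OF diff[of n]] by simp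
    qed
    then have "(\<lambda>n. adj (X n)) \<longlonglongrightarrow> adj a"
      using X(2) by (subst (asm) LIM_zero_iff[symmetric], subst LIM_zero_iff[symmetric])
        (erule Lim_null_comparison[OF always_eventually, rotated, OF tendsto_norm_zero], simp)
    moreover have "adj (X n) \<in> S" for n using X(1) S by (simp add: star_subalgebra_def)
    ultimately show ?thesis unfolding closure_sequential by (intro exI[of _ "\<lambda>n. adj (X n)"]) simp
  qed
  moreover have "a + b \<in> closure S \<and> a o\<^sub>L b \<in> closure S"
    if a: "a \<in> closure S" and b: "b \<in> closure S" for a b
  proof -
    obtain X Y where X: "\<And>n. X n \<in> S" "X \<longlonglongrightarrow> a" and Y: "\<And>n. Y n \<in> S" "Y \<longlonglongrightarrow> b"
      using a b unfolding closure_sequential by blast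
    have "X n + Y n \<in> S \<and> X n o\<^sub>L Y n \<in> S" for n using X Y S by (simp add: star_subalgebra_def)
    moreover have "(\<lambda>n. X n + Y n) \<longlonglongrightarrow> a + b" using X Y by (intro tendsto_add)
    moreover have "(\<lambda>n. X n o\<^sub>L Y n) \<longlonglongrightarrow> (a o\<^sub>L b)"
      by (rule bounded_bilinear.tendsto[OF bounded_bilinear_blinfun_compose X(2) Y(2)])
    ultimately show ?thesis
      unfolding closure_sequential
      by (intro conjI exI[where P = "\<lambda>Z. (\<forall>n. Z n \<in> S) \<and> Z \<longlonglongrightarrow> a + b", of "\<lambda>n. X n + Y n"]
          exI[where P = "\<lambda>Z. (\<forall>n. Z n \<in> S) \<and> Z \<longlonglongrightarrow> (a o\<^sub>L b)", of "\<lambda>n. X n o\<^sub>L Y n"]) auto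
  qed
  moreover have "c \<cdot>\<^sub>C a \<in> closure S" if a: "a \<in> closure S" for c a
  proof -
    obtain X where X: "\<And>n. X n \<in> S" "X \<longlonglongrightarrow> a" using a unfolding closure_sequential by blast
    have "c \<cdot>\<^sub>C X n \<in> S" for n using X S by (simp add: star_subalgebra_def)
    then show ?thesis
      using scale[OF X(2), of c] unfolding closure_sequential
      by (intro exI[where P = "\<lambda>Z. (\<forall>n. Z n \<in> S) \<and> Z \<longlonglongrightarrow> c \<cdot>\<^sub>C a", of "\<lambda>n. c \<cdot>\<^sub>C X n"]) simp
  qed
  moreover have "0 \<in> closure S" using S closure_subset by (auto simp: star_subalgebra_def)
  ultimately show ?thesis unfolding star_subalgebra_def using closed by blast
qed

text \<open>The closure of \<open>S\<close> is a norm-closed star subalgebra containing the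
  generators, hence one of the algebras intersected in the hull. Elements of \<open>BDT N\<close>
  can thus be approximated from any convenient algebra \<open>S\<close>.\<close>

lemma BDT_minimal:
  assumes "star_subalgebra S" "shift \<in> S" "diag_per N \<subseteq> S"
  shows "BDT N \<subseteq> closure S"
  unfolding BDT_def using assms closure_subset[of S] star_subalgebra_closure[of S]
  by (intro hull_minimal) (auto simp: cstar_subalgebra_def)

lemma star_subalgebra_BDT: "star_subalgebra (BDT N)"
proof -
  \<comment> \<open>Being a star subalgebra, the closure lies in \<open>bounded_ops\<close> again,
    so \<open>bounded_ops\<close> is norm closed and takes part in the hull.\<close>
  have "star_subalgebra (closure bounded_ops)"
    by (rule star_subalgebra_closure[OF star_subalgebra_bounded_ops])
  then have "closure bounded_ops \<subseteq> bounded_ops" by (simp add: star_subalgebra_def)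
  then have "cstar_subalgebra bounded_ops"
    by (metis closure_subset_eq star_subalgebra_bounded_ops cstar_subalgebra_def)
  then have "BDT N \<subseteq> bounded_ops"
    unfolding BDT_def using shift_in_bounded_ops diag_per_subset by (intro hull_minimal) auto
  then show ?thesis
    unfolding BDT_def hull_def cstar_subalgebra_def star_subalgebra_def by blast
qed

lemma BDT_alg_subset_BDT: "BDT_alg N \<subseteq> BDT N"
proof -
  have "insert shift (diag_per N) \<subseteq> BDT N" unfolding BDT_def by (rule hull_subset)
  then show ?thesis
    unfolding BDT_alg_def using star_subalgebra_BDT[of N]
    by (intro hull_minimal) (auto simp: star_subalgebra_def)
qed

lemma star_subalgebraD:
  assumes "star_subalgebra S"
  shows "a \<in> S \<Longrightarrow> a \<in> bounded_ops"
    "0 \<in> S"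
    "a \<in> S \<Longrightarrow> b \<in> S \<Longrightarrow> a + b \<in> S"
    "a \<in> S \<Longrightarrow> c \<cdot>\<^sub>C a \<in> S"
    "a \<in> S \<Longrightarrow> b \<in> S \<Longrightarrow> a o\<^sub>L b \<in> S"
    "a \<in> S \<Longrightarrow> adj a \<in> S"
  using assms unfolding star_subalgebra_def by blast+

lemma star_subalgebra_diff:
  assumes "star_subalgebra S" "a \<in> S" "b \<in> S"
  shows "a - b \<in> S"
proof -
  have "a - b = a + (-1) \<cdot>\<^sub>C b"
    by (rule blinfun_eqI, rule ell2_eqI) (simp add: blinfun.diff_left blinfun.add_left)
  moreover have "a + (-1) \<cdot>\<^sub>C b \<in> S"
    using assms unfolding star_subalgebra_def by blast
  ultimately show ?thesis by (simp only:)
qed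

lemma star_subalgebra_sum:
  assumes "star_subalgebra S" "\<And>i. i \<in> I \<Longrightarrow> f i \<in> S"
  shows "sum f I \<in> S"
  using assms(2) by (induction I rule: infinite_finite_induct) (auto simp: star_subalgebraD[OF assms(1)])

section \<open>Divisors of a supernatural number\<close>

lemma supernatural_dvd_1 [simp]: "supernatural_dvd (Suc 0) N"
  by (simp add: supernatural_dvd_def flip: zero_enat_def)

lemma supernatural_dvd_lcm:
  assumes "supernatural_dvd i N" "supernatural_dvd j N"
  shows "supernatural_dvd (lcm i j) N"
  using assms by (auto simp: supernatural_dvd_def multiplicity_lcm max_def lcm_pos_nat)

text \<open>An infinite \<open>N\<close> either has an infinite exponent at some prime, all of whose
  powers then divide \<open>N\<close>, or has infinitely many prime divisors, among them arbitrarily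
  large ones.\<close>

lemma supernatural_dvd_unbounded:
  assumes "\<not> supernatural_finite N"
  shows "\<exists>j>M. supernatural_dvd j N"
proof (cases "\<exists>p. prime p \<and> N p = \<infinity>")
  case True
  then obtain p where p: "prime p" "N p = \<infinity>" by blast
  have "enat (multiplicity q (p ^ Suc M)) \<le> N q" if "prime q" for q
    using p that multiplicity_distinct_prime_power[of q p "Suc M"]
    by (cases "q = p") (simp_all del: power_Suc flip: zero_enat_def)
  then have "supernatural_dvd (p ^ Suc M) N"
    using prime_gt_0_nat[OF p(1)] unfolding supernatural_dvd_def by simp
  moreover have "M < p ^ Suc M"
    using less_exp[of "Suc M"] power_mono[OF prime_ge_2_nat[OF p(1)], of "Suc M"] by linarith
  ultimately show ?thesis by blast
next
  case False
  then have "infinite {p. prime p \<and> N p \<noteq> 0}"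
    using assms by (auto simp: supernatural_finite_iff)
  then obtain p where p: "p > M" "prime p" "N p \<noteq> 0"
    unfolding infinite_nat_iff_unbounded by blast
  have "enat (multiplicity q p) \<le> N q" if "prime q" for q
  proof (cases "q = p")
    case True
    then show ?thesis using p by (cases "N p") (auto simp: zero_enat_def)
  next
    case False
    then show ?thesis
      using multiplicity_distinct_prime_power[of q p 1] p that by (simp flip: zero_enat_def)
  qed
  then show ?thesis using p unfolding supernatural_dvd_def by (metis prime_gt_0_nat)
qed

text \<open>Taking the least common multiple of all divisors up to \<open>n\<close> replaces the
  directed set of divisors by an ordinary sequence. It tends to infinity because divisors are
  unbounded.\<close>

lemma supernatural_dvd_cofinal:
  assumes "\<not> supernatural_finite N"
  obtains j where "\<And>n. supernatural_dvd (j n) N"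
    "\<And>i. supernatural_dvd i N \<Longrightarrow> \<forall>\<^sub>F n in sequentially. i dvd j n"
    "filterlim j at_top sequentially"
proof
  let ?S = "\<lambda>n. {i \<in> {..n}. supernatural_dvd i N}"
  define j where "j n = Lcm (?S n)" for n
  have "supernatural_dvd (Lcm F) N" if "finite F" "\<And>i. i \<in> F \<Longrightarrow> supernatural_dvd i N" for F
    using that by (induction F) (auto intro: supernatural_dvd_lcm)
  then show j: "supernatural_dvd (j n) N" for n unfolding j_def by fastforce
  show ev: "\<forall>\<^sub>F n in sequentially. i dvd j n" if "supernatural_dvd i N" for i
    using eventually_ge_at_top[of i] by eventually_elim (use that in \<open>auto simp: j_def\<close>)
  show "filterlim j at_top sequentially"
    unfolding filterlim_at_top
  proof
    fix M
    obtain i where i: "i > M" "supernatural_dvd i N" using supernatural_dvd_unbounded[OF assms] by blast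
    from ev[OF i(2)] show "\<forall>\<^sub>F n in sequentially. M \<le> j n"
    proof eventually_elim
      case (elim n)
      then have "i \<le> j n" using j[of n] by (simp add: dvd_imp_le supernatural_dvd_def)
      then show ?case using i by simp
    qed
  qed
qed

section \<open>Band operators with eventually periodic diagonals\<close>

text \<open>Periodicity is asked only from \<open>L\<close> on, since otherwise products would leave
  the class: the main diagonal of \<open>shift o\<^sub>L adj shift\<close> is 0 at index 0 and 1
  afterwards.\<close>

definition band_per :: "nat \<Rightarrow> nat \<Rightarrow> nat \<Rightarrow> (ell2 \<Rightarrow>\<^sub>L ell2) \<Rightarrow> bool" where
  "band_per M j L T \<longleftrightarrow>
     (\<forall>k l. l + M < k \<or> k + M < l \<longrightarrow> entry T k l = 0) \<and>
     (\<forall>k\<ge>L. \<forall>l\<ge>L. entry T (k + j) (l + j) = entry T k l)"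

lemma band_per_mono:
  assumes T: "band_per M j L T" and le: "M \<le> M'" "j dvd j'" "L \<le> L'"
  shows "band_per M' j' L' T"
proof -
  have "entry T (k + j * c) (l + j * c) = entry T k l" if "k \<ge> L" "l \<ge> L" for k l c
  proof (induction c)
    case (Suc c)
    have "entry T (k + j * Suc c) (l + j * Suc c) = entry T ((k + j * c) + j) ((l + j * c) + j)"
      by (simp add: ac_simps)
    also have "\<dots> = entry T (k + j * c) (l + j * c)"
      using T that unfolding band_per_def by (meson trans_le_add1)
    finally show ?case by (simp only: Suc)
  qed simp
  then show ?thesis using T le unfolding band_per_def by (auto elim!: dvdE)
qed

definition band_periodic :: "supernatural \<Rightarrow> (ell2 \<Rightarrow>\<^sub>L ell2) set" where
  "band_periodic N = {T \<in> bounded_ops. \<exists>M j L. supernatural_dvd j N \<and> band_per M j L T}"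

lemma band_periodic_common:
  assumes "S \<in> band_periodic N" "T \<in> band_periodic N"
  obtains M j L where "supernatural_dvd j N" "band_per M j L S" "band_per M j L T"
proof -
  from assms obtain M j L M' j' L' where
    S: "supernatural_dvd j N" "band_per M j L S" and T: "supernatural_dvd j' N" "band_per M' j' L' T"
    unfolding band_periodic_def by blast
  show ?thesis
    using supernatural_dvd_lcm[OF S(1) T(1)]
      band_per_mono[OF S(2), of "max M M'" "lcm j j'" "max L L'"]
      band_per_mono[OF T(2), of "max M M'" "lcm j j'" "max L L'"]
    by (intro that[of "lcm j j'" "max M M'" "max L L'"]) simp_all
qed

lemma basis_image_band:
  assumes "\<And>k. l + M < k \<Longrightarrow> entry T k l = 0" "l + M < K"
  shows "T (basis l) = (\<Sum>m<K. entry T m l *\<^sub>C basis m)"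
  by (rule ell2_eqI) (use assms in \<open>simp add: basis_trunc del: coord_sum, simp add: entry_def\<close>)

text \<open>Column \<open>l\<close> of \<open>T\<close> has finite support, so the matrix product is
  a finite sum, and any cutoff \<open>K\<close> beyond the band gives the same value.\<close>

lemma entry_compose_band:
  assumes S: "S \<in> bounded_ops" and T: "\<And>k. l + M < k \<Longrightarrow> entry T k l = 0" and K: "l + M < K"
  shows "entry (S o\<^sub>L T) k l = (\<Sum>m<K. entry S k m * entry T m l)"
proof -
  have "T (basis l) = (\<Sum>m<K. entry T m l *\<^sub>C basis m)"
    using T K by (rule basis_image_band)
  then have "S (T (basis l)) = (\<Sum>m<K. entry T m l *\<^sub>C S (basis m))"
    by (simp add: blinfun.sum_right op_scale[OF S])
  then show ?thesis by (simp add: entry_def mult.commute)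
qed

text \<open>Translating both indices by \<open>j\<close> translates the summation index too. Raising
  the threshold by \<open>M\<close> keeps every contributing index \<open>m\<close> at least
  \<open>L\<close>, because \<open>entry S k m\<close> vanishes when
  \<open>m + M < k\<close>.\<close>

lemma band_per_compose:
  assumes b: "S \<in> bounded_ops" and S: "band_per M j L S" and T: "band_per M j L T"
  shows "band_per (2 * M) j (L + M) (S o\<^sub>L T)"
  unfolding band_per_def
proof (intro conjI allI impI)
  have S0: "entry S k l = 0" if "l + M < k \<or> k + M < l" for k l
    using S that unfolding band_per_def by blast
  have T0: "entry T k l = 0" if "l + M < k \<or> k + M < l" for k l
    using T that unfolding band_per_def by blast
  have prod: "entry (S o\<^sub>L T) k l = (\<Sum>m<Suc (l + M). entry S k m * entry T m l)" for k l
    by (rule entry_compose_band[OF b, of l M]) (simp_all add: T0)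
  show "entry (S o\<^sub>L T) k l = 0" if "l + 2 * M < k \<or> k + 2 * M < l" for k l
  proof -
    have "entry S k m * entry T m l = 0" for m
      using S0[of m k] T0[of l m] that by (cases "m + M < k \<or> k + M < m") auto
    then show ?thesis unfolding prod by (intro sum.neutral) blast
  qed
  fix k l assume kl: "L + M \<le> k" "L + M \<le> l"
  have "entry (S o\<^sub>L T) (k + j) (l + j) =
      (\<Sum>m<Suc (l + j + M). entry S (k + j) m * entry T m (l + j))" by (rule prod)
  \<comment> \<open>Indices below \<open>L + j\<close> lie more than \<open>M\<close> below
    \<open>k + j\<close>, outside the band of \<open>S\<close>.\<close>
  also have "\<dots> = (\<Sum>m=L + j..<Suc (l + M) + j. entry S (k + j) m * entry T m (l + j))"
    by (rule sum.mono_neutral_right) (use kl in \<open>auto intro!: S0\<close>)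
  also have "\<dots> = (\<Sum>m=L..<Suc (l + M). entry S (k + j) (m + j) * entry T (m + j) (l + j))"
    by (rule sum.shift_bounds_nat_ivl)
  also have "\<dots> = (\<Sum>m=L..<Suc (l + M). entry S k m * entry T m l)"
    by (rule sum.cong) (use S T kl in \<open>auto simp: band_per_def\<close>)
  also have "\<dots> = (\<Sum>m<Suc (l + M). entry S k m * entry T m l)"
    by (rule sum.mono_neutral_left) (use kl in \<open>auto intro!: S0\<close>)
  finally show "entry (S o\<^sub>L T) (k + j) (l + j) = entry (S o\<^sub>L T) k l" by (simp only: prod)
qed

lemma star_subalgebra_band_periodic: "star_subalgebra (band_periodic N)"
proof -
  note b = star_subalgebraD[OF star_subalgebra_bounded_ops]
  have "S + T \<in> band_periodic N \<and> S o\<^sub>L T \<in> band_periodic N"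
    if ST: "S \<in> band_periodic N" "T \<in> band_periodic N" for S T
  proof -
    obtain M j L where *: "supernatural_dvd j N" "band_per M j L S" "band_per M j L T"
      using band_periodic_common[OF ST] .
    then have "band_per M j L (S + T)" by (simp add: band_per_def)
    with * ST show ?thesis
      unfolding band_periodic_def using band_per_compose[OF _ *(2,3)] b(3,5) by blast
  qed
  moreover have "c \<cdot>\<^sub>C T \<in> band_periodic N \<and> adj T \<in> band_periodic N" if T: "T \<in> band_periodic N" for c T
  proof -
    obtain M j L where *: "supernatural_dvd j N" "band_per M j L T" "T \<in> bounded_ops"
      using T unfolding band_periodic_def by blast
    then have "band_per M j L (c \<cdot>\<^sub>C T)" "band_per M j L (adj T)"
      by (auto simp: band_per_def entry_adj)
    with * T show ?thesis unfolding band_periodic_def using b(4,6) by blast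
  qed
  moreover have "0 \<in> band_periodic N"
    unfolding band_periodic_def band_per_def using b(2) by (auto intro: exI[of _ "Suc 0"])
  ultimately show ?thesis unfolding star_subalgebra_def by (auto simp: band_periodic_def)
qed

lemma shift_in_band_periodic: "shift \<in> band_periodic N"
proof -
  have "band_per 1 1 0 shift" by (auto simp: band_per_def entry_shift)
  then show ?thesis
    using shift_in_bounded_ops supernatural_dvd_1[of N] unfolding band_periodic_def One_nat_def by blast
qed

lemma diag_per_subset_band_periodic: "diag_per N \<subseteq> band_periodic N"
proof
  fix T assume T: "T \<in> diag_per N"
  then obtain a j where a: "T = diag_op a" "supernatural_dvd j N" "\<forall>k. a (k + j) = a k"
    unfolding diag_per_def by blast
  then obtain B where "\<And>k. cmod (a k) \<le> B" using periodic_bounded unfolding supernatural_dvd_def by blast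
  from entry_diag_op[OF this] have "band_per 0 j 0 T" using a by (auto simp: band_per_def)
  then show "T \<in> band_periodic N"
    using a(2) T diag_per_subset unfolding band_periodic_def by blast
qed

lemma BDT_approx:
  assumes "T \<in> BDT N" "0 < e"
  obtains S where "S \<in> band_periodic N" "norm (T - S) < e"
proof -
  have "T \<in> closure (band_periodic N)"
    using BDT_minimal[OF star_subalgebra_band_periodic shift_in_band_periodic
        diag_per_subset_band_periodic] assms(1) by blast
  then show ?thesis using assms(2) that
    unfolding closure_approachable by (metis dist_norm norm_minus_commute)
qed

lemma BDT_alg_subset_band_periodic: "BDT_alg N \<subseteq> band_periodic N"
  unfolding BDT_alg_def
  using star_subalgebra_band_periodic[of N] shift_in_band_periodic[of N] diag_per_subset_band_periodic[of N]
  by (intro hull_minimal) (auto intro: star_subalgebraD(6))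

text \<open>Elements of \<open>BDT_alg N\<close> are banded, so their columns have finite support.
  This keeps \<open>number_op\<close> meaningful on the vectors occurring in the Leibniz rule for
  \<open>number_commutator\<close>.\<close>

lemma preserves_span_BDT_alg:
  assumes "a \<in> BDT_alg N"
  shows "preserves_span a"
proof -
  have "a \<in> band_periodic N" using assms BDT_alg_subset_band_periodic by blast
  then obtain M j L where a: "a \<in> bounded_ops" "band_per M j L a"
    unfolding band_periodic_def by blast
  have "a (basis l) \<in> finite_span" for l
  proof -
    have "entry a k l = 0" if "l + M < k" for k
      using a(2) that unfolding band_per_def by blast
    then have "a (basis l) = (\<Sum>m<Suc (l + M). entry a m l *\<^sub>C basis m)"
      using lessI by (rule basis_image_band)
    also have "\<dots> \<in> finite_span"
      by (intro ell2.span_sum ell2.span_scale basis_in_span)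
    finally show ?thesis .
  qed
  then show ?thesis by (rule preserves_spanI[OF a(1)])
qed

section \<open>Eventually periodic sequences\<close>

lemma ev_periodic_bounded:
  fixes a :: "nat \<Rightarrow> complex"
  assumes "0 < j" "\<And>k. L \<le> k \<Longrightarrow> a (k + j) = a k"
  obtains B where "\<And>k. cmod (a k) \<le> B"
proof -
  have "\<forall>k. a (L + (k + j)) = a (L + k)" using assms(2)[of "L + _"] by (simp add: add.assoc)
  then obtain B where B: "\<And>k. cmod (a (L + k)) \<le> B"
    using periodic_bounded[OF assms(1), of "\<lambda>k. a (L + k)"] by blast
  have "cmod (a k) \<le> max B (\<Sum>i<L. cmod (a i))" for k
  proof (cases "k < L")
    case True
    then show ?thesis by (intro max.coboundedI2 member_le_sum) auto
  next
    case False
    then show ?thesis using B[of "k - L"] by simp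
  qed
  then show ?thesis by (rule that)
qed

text \<open>Such a sequence is a periodic one plus a finitely supported one. The first gives a
  generator. For the second, the projection onto \<open>basis 0\<close> is
  \<open>id_blinfun - (shift o\<^sub>L adj shift)\<close>, and conjugating with the shift produces
  the projections onto the other basis vectors.\<close>

lemma diag_op_ev_periodic_in_BDT_alg:
  assumes j: "supernatural_dvd j N" and a: "\<And>k. L \<le> k \<Longrightarrow> a (k + j) = a k"
  shows "diag_op a \<in> BDT_alg N"
proof -
  note A = star_subalgebraD[OF star_subalgebra_BDT_alg[of N]]
  have gen: "shift \<in> BDT_alg N" "adj shift \<in> BDT_alg N" "diag_per N \<subseteq> BDT_alg N"
    using hull_subset[of "{shift, adj shift} \<union> diag_per N" star_subalgebra] unfolding BDT_alg_def by auto
  have j0: "0 < j" using j by (simp add: supernatural_dvd_def)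
  define E where "E n = diag_op (\<lambda>k. if k = n then 1 else 0)" for n
  have Eb: "cmod (if k = n then 1 else 0) \<le> 1" for k n :: nat by simp
  have Ee: "entry (E n) k l = (if k = l then if k = n then 1 else 0 else 0)" for n k l
    by (simp add: E_def entry_diag_op[OF Eb])
  have adjU: "entry (T o\<^sub>L adj shift) k l = (if l = 0 then 0 else entry T k (l - 1))" for T k l
    by (simp add: entry_def adj_shift_basis)
  have "E n \<in> BDT_alg N" for n
  proof (induction n)
    case 0
    have 1: "diag_op (\<lambda>_. 1) \<in> BDT_alg N"
    proof -
      have "diag_op (\<lambda>_. 1) \<in> diag_per N"
        unfolding diag_per_def mem_Collect_eq
        by (rule exI[of _ "\<lambda>_. 1"]) (auto intro: exI[of _ "Suc 0"])
      then show ?thesis using gen(3) by blast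
    qed
    have "E 0 = diag_op (\<lambda>_. 1) - (shift o\<^sub>L adj shift)"
    proof (rule bounded_ops_entryI)
      show "diag_op (\<lambda>_. 1) - (shift o\<^sub>L adj shift) \<in> bounded_ops"
        by (intro A(1) star_subalgebra_diff[OF star_subalgebra_BDT_alg] A(5) 1 gen)
      show "E 0 \<in> bounded_ops" unfolding E_def by (rule diag_op_in_bounded_ops[OF Eb])
      show "entry (E 0) k l = entry (diag_op (\<lambda>_. 1) - (shift o\<^sub>L adj shift)) k l" for k l
        by (auto simp: E_def entry_diag_op[OF Eb] entry_diag_op[of "\<lambda>_. 1" 1] adjU entry_shift)
    qed
    then show ?case
      using star_subalgebra_diff[OF star_subalgebra_BDT_alg 1 A(5)[OF gen(1,2)]] by simp
  next
    case (Suc n)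
    have S: "shift o\<^sub>L (E n o\<^sub>L adj shift) \<in> BDT_alg N" by (intro A(5) gen Suc)
    have "E (Suc n) = shift o\<^sub>L (E n o\<^sub>L adj shift)"
    proof (rule bounded_ops_entryI)
      show "E (Suc n) \<in> bounded_ops" unfolding E_def by (rule diag_op_in_bounded_ops[OF Eb])
      show "shift o\<^sub>L (E n o\<^sub>L adj shift) \<in> bounded_ops" using S A(1) by blast
      show "entry (E (Suc n)) k l = entry (shift o\<^sub>L (E n o\<^sub>L adj shift)) k l" for k l
        by (auto simp: shift_compose_entry adjU E_def entry_diag_op[OF Eb])
    qed
    then show ?case using S by simp
  qed
  then have E: "c \<cdot>\<^sub>C E n \<in> BDT_alg N" for c n by (rule A(4))
  \<comment> \<open>The offset is a multiple of \<open>j\<close> and at least \<open>L\<close>: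
    every index is moved into the periodic range within its own residue class.\<close>
  define b where "b k = a (k + L * j)" for k
  have bper: "\<forall>k. b (k + j) = b k"
  proof
    fix k
    have "L \<le> k + L * j" using j0 by (simp add: trans_le_add2)
    then have "a ((k + L * j) + j) = a (k + L * j)" by (rule a)
    then show "b (k + j) = b k" by (simp add: b_def ac_simps)
  qed
  have ab: "b k = a k" if "L \<le> k" for k
  proof -
    have "a (k + c * j) = a k" for c
    proof (induction c)
      case (Suc c)
      have "a (k + Suc c * j) = a ((k + c * j) + j)" by (simp add: ac_simps)
      also have "\<dots> = a (k + c * j)" using that by (intro a) simp
      finally show ?case by (simp only: Suc)
    qed simp
    then show ?thesis by (simp only: b_def)
  qed
  have bA: "diag_op b \<in> BDT_alg N" using gen(3) j bper unfolding diag_per_def by blast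
  obtain Ba where Ba: "\<And>k. cmod (a k) \<le> Ba" using ev_periodic_bounded[of j L a] j0 a by blast
  obtain Bb where Bb: "\<And>k. cmod (b k) \<le> Bb" using periodic_bounded[OF j0 bper] by blast
  have esum: "entry (\<Sum>i\<in>I. (a i - b i) \<cdot>\<^sub>C E i) k l = (\<Sum>i\<in>I. entry ((a i - b i) \<cdot>\<^sub>C E i) k l)"
    for I :: "nat set" and k l
    by (induction I rule: infinite_finite_induct) auto
  have mem: "diag_op b + (\<Sum>i<L. (a i - b i) \<cdot>\<^sub>C E i) \<in> BDT_alg N"
    by (intro A(3) bA star_subalgebra_sum[OF star_subalgebra_BDT_alg] E)
  have "diag_op a = diag_op b + (\<Sum>i<L. (a i - b i) \<cdot>\<^sub>C E i)"
  proof (rule bounded_ops_entryI)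
    show "diag_op a \<in> bounded_ops" by (rule diag_op_in_bounded_ops[OF Ba])
    show "diag_op b + (\<Sum>i<L. (a i - b i) \<cdot>\<^sub>C E i) \<in> bounded_ops" using mem A(1) by blast
    show "entry (diag_op a) k l = entry (diag_op b + (\<Sum>i<L. (a i - b i) \<cdot>\<^sub>C E i)) k l" for k l
      using ab[of k] by (auto simp: esum Ee entry_diag_op[OF Ba] entry_diag_op[OF Bb]
          if_distrib[of "\<lambda>x. _ * x"] cong: if_cong)
  qed
  then show ?thesis using mem by simp
qed

text \<open>The constant \<open>c\<close> is the mean of \<open>h\<close> over an eventual period.\<close>

lemma ev_periodic_antidifference:
  fixes h :: "nat \<Rightarrow> complex"
  assumes j: "0 < j" and h: "\<And>k. L \<le> k \<Longrightarrow> h (k + j) = h k"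
  obtains b c where "\<And>k. L \<le> k \<Longrightarrow> b (k + j) = b k" "\<And>k. h k = b (Suc k) - b k + c"
proof -
  define c where "c = (\<Sum>i=L..<L + j. h i) / of_nat j"
  \<comment> \<open>From \<open>L\<close> to \<open>L + j\<close> the sequence \<open>b\<close>
    grows by the sum of \<open>h - c\<close> over one full period, which is 0 by the choice of
    \<open>c\<close>. This is the base of the induction.\<close>
  define b where "b k = (\<Sum>i<k. h i - c)" for k
  have "b (k + j) = b k" if "L \<le> k" for k
    using that
  proof (induction k rule: dec_induct)
    case base
    have "b (L + j) = b L + (\<Sum>i=L..<L + j. h i - c)"
      unfolding b_def lessThan_atLeast0 by (simp add: sum.atLeastLessThan_concat)
    then show ?case using j by (simp add: sum_subtractf c_def)
  next
    case (step k)
    then show ?case using h[of k] by (simp add: b_def)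
  qed
  moreover have "h k = b (Suc k) - b k + c" for k by (simp add: b_def)
  ultimately show ?thesis by (rule that)
qed

text \<open>Summing the first \<open>K\<close> expressions telescopes to
  \<open>b K - b 0 + of_nat K * c\<close>, of modulus at most \<open>real K * e\<close>. The
  boundary terms stay bounded, so they cannot compensate a modulus of \<open>c\<close> above
  \<open>e\<close> once \<open>K\<close> is large. This controls means, both for their convergence
  and for the uniqueness of the constant.\<close>

lemma norm_le_of_bounded_antidifference:
  fixes b :: "nat \<Rightarrow> complex"
  assumes b: "\<And>k. cmod (b k) \<le> B" and e: "\<And>k. cmod (b (Suc k) - b k + c) \<le> e"
  shows "cmod c \<le> e"
proof (rule ccontr)
  assume "\<not> cmod c \<le> e"
  then obtain K :: nat where K: "2 * B < real K * (cmod c - e)"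
    using reals_Archimedean3[of "cmod c - e"] by (metis diff_gt_0_iff_gt not_le mult.commute)
  have "cmod (b k - b 0 + of_nat k * c) \<le> real k * e" for k
  proof (induction k)
    case (Suc k)
    have "b (Suc k) - b 0 + of_nat (Suc k) * c = (b k - b 0 + of_nat k * c) + (b (Suc k) - b k + c)"
      by (simp add: algebra_simps)
    then show ?case
      using norm_triangle_le[OF add_mono[OF Suc e[of k]]] by (simp add: algebra_simps)
  qed simp
  moreover have "real K * cmod c \<le> cmod (b K - b 0 + of_nat K * c) + cmod (b K) + cmod (b 0)"
  proof -
    have "of_nat K * c = (b K - b 0 + of_nat K * c) - b K + b 0" by simp
    then have "cmod (of_nat K * c) \<le> cmod (b K - b 0 + of_nat K * c) + cmod (b K) + cmod (b 0)"
      by (metis norm_triangle_ineq norm_triangle_ineq4 order_trans add_right_mono)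
    then show ?thesis by (simp add: norm_mult)
  qed
  ultimately have "real K * cmod c \<le> real K * e + cmod (b K) + cmod (b 0)" by (smt (verit))
  then show False using K b[of K] b[of 0] by (simp add: algebra_simps)
qed

section \<open>Residue class projections\<close>

text \<open>Reducing \<open>i\<close> modulo \<open>j\<close> makes the index cyclic, so that
  \<open>Suc i\<close> always names the next class, even for \<open>i = j - 1\<close>.\<close>

definition res_proj :: "nat \<Rightarrow> nat \<Rightarrow> (ell2 \<Rightarrow>\<^sub>L ell2)" where
  "res_proj j i = diag_op (\<lambda>k. if k mod j = i mod j then 1 else 0)"

lemma res_proj_bound: "cmod (if k mod j = i mod j then 1 else 0) \<le> 1"
  by simp

lemma coord_res_proj: "coord (res_proj j i x) k = (if k mod j = i mod j then coord x k else 0)"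
  unfolding res_proj_def by (subst coord_diag_op[where B = 1]) auto

lemma res_proj_in_diag_per: "supernatural_dvd j N \<Longrightarrow> res_proj j i \<in> diag_per N"
  unfolding res_proj_def diag_per_def mem_Collect_eq
  by (intro exI[of _ "\<lambda>k. if k mod j = i mod j then 1 else 0"] conjI refl exI[of _ j]) simp_all

lemma diag_per_subset_BDT_alg: "diag_per N \<subseteq> BDT_alg N"
  and shift_in_BDT_alg: "shift \<in> BDT_alg N"
  and adj_shift_in_BDT_alg: "adj shift \<in> BDT_alg N"
  using hull_subset[of "{shift, adj shift} \<union> diag_per N" star_subalgebra]
  unfolding BDT_alg_def by auto

lemma res_proj_in_BDT_alg: "supernatural_dvd j N \<Longrightarrow> res_proj j i \<in> BDT_alg N"
  using res_proj_in_diag_per diag_per_subset_BDT_alg by blast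

lemma res_proj_idem [simp]: "res_proj j i (res_proj j i x) = res_proj j i x"
  by (rule ell2_eqI) (simp add: coord_res_proj)

lemma res_proj_orthogonal:
  "i < j \<Longrightarrow> k < j \<Longrightarrow> i \<noteq> k \<Longrightarrow> res_proj j i (res_proj j k x) = 0"
  by (rule ell2_eqI) (simp add: coord_res_proj)

lemma res_proj_mod: "res_proj j (i mod j) = res_proj j i"
  by (simp add: res_proj_def)

lemma sum_res_proj: "0 < j \<Longrightarrow> (\<Sum>i<j. res_proj j i) = id_blinfun"
  by (rule blinfun_eqI, rule ell2_eqI)
    (simp add: blinfun.sum_left coord_res_proj cong: if_cong)

lemma Suc_mod_eq_iff: "Suc k mod j = Suc i mod j \<longleftrightarrow> k mod j = i mod (j::nat)"
  using cong_add_rcancel_nat[of k 1 i j] unfolding cong_def by simp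

lemma shift_res_proj: "shift o\<^sub>L res_proj j i = res_proj j (Suc i) o\<^sub>L shift"
  by (rule blinfun_eqI, rule ell2_eqI)
    (simp add: coord_res_proj shift_fun.rep_eq Suc_mod_eq_iff split: nat.split)

lemma adj_shift_res_proj: "adj shift o\<^sub>L res_proj j (Suc i) = res_proj j i o\<^sub>L adj shift"
  by (rule blinfun_eqI, rule ell2_eqI) (simp add: coord_res_proj coord_adj_shift Suc_mod_eq_iff)

text \<open>This is Pythagoras: the summands have disjoint supports, each coordinate
  \<open>k\<close> being hit by exactly one \<open>i < j\<close>. The offset \<open>s\<close> is
  needed because \<open>res_part\<close> maps class \<open>i\<close> to class
  \<open>i + 1\<close>.\<close>

lemma norm_sum_res_proj:
  assumes j: "0 < j"
  shows "(norm (\<Sum>i<j. res_proj j (i + s) (u i)))\<^sup>2 = (\<Sum>i<j. (norm (res_proj j (i + s) (u i)))\<^sup>2)"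
proof -
  have "(cmod (coord (\<Sum>i<j. res_proj j (i + s) (u i)) k))\<^sup>2 =
      (\<Sum>i<j. (cmod (coord (res_proj j (i + s) (u i)) k))\<^sup>2)" for k
  proof -
    obtain i where i: "i < j" "k mod j = (i + s) mod j"
    proof
      \<comment> \<open>The residue of \<open>k - s\<close>, written so that natural subtraction
        does not truncate.\<close>
      let ?i = "(k + (j - s mod j)) mod j"
      show "?i < j" using j by simp
      have "(?i + s) mod j = (k + (j - s mod j) + s mod j) mod j" by (simp add: mod_simps)
      also have "\<dots> = k mod j" using mod_less_divisor[OF j, of s] by (simp del: mod_less_divisor)
      finally show "k mod j = (?i + s) mod j" by simp
    qed
    have z: "coord (res_proj j (i' + s) (u i')) k = 0" if "i' \<in> {..<j} - {i}" for i'
    proof -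
      have "(i' + s) mod j \<noteq> (i + s) mod j"
        using that i cong_add_rcancel_nat[of i' s i j] unfolding cong_def by simp
      then show ?thesis using i by (simp add: coord_res_proj)
    qed
    have "coord (\<Sum>i<j. res_proj j (i + s) (u i)) k = coord (res_proj j (i + s) (u i)) k"
      unfolding coord_sum using i(1) z by (subst sum.remove[of _ i]) simp_all
    moreover have "(\<Sum>i<j. (cmod (coord (res_proj j (i + s) (u i)) k))\<^sup>2) =
        (cmod (coord (res_proj j (i + s) (u i)) k))\<^sup>2"
      using i(1) z by (subst sum.remove[of _ i]) simp_all
    ultimately show ?thesis by simp
  qed
  moreover have "(\<lambda>k. \<Sum>i<j. (cmod (coord (res_proj j (i + s) (u i)) k))\<^sup>2) sums
      (\<Sum>i<j. (norm (res_proj j (i + s) (u i)))\<^sup>2)"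
    by (intro sums_sum norm_sums)
  ultimately show ?thesis using sums_unique2[OF norm_sums] by (simp del: coord_sum)
qed

lemma norm_res_proj_le: "norm (res_proj j i x) \<le> norm x"
proof -
  have "norm (res_proj j i) \<le> 1"
    unfolding res_proj_def by (rule norm_diag_op_le) simp
  then show ?thesis
    using norm_blinfun[of "res_proj j i" x] mult_right_mono[of "norm (res_proj j i)" 1 "norm x"]
    by simp
qed

section \<open>The part of an operator on the diagonals congruent to the first subdiagonal\<close>

definition res_part :: "nat \<Rightarrow> (ell2 \<Rightarrow>\<^sub>L ell2) \<Rightarrow> (ell2 \<Rightarrow>\<^sub>L ell2)" where
  "res_part j T = (\<Sum>i<j. res_proj j (Suc i) o\<^sub>L T o\<^sub>L res_proj j i)"

lemma res_part_apply: "res_part j T x = (\<Sum>i<j. res_proj j (i + 1) (T (res_proj j i x)))"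
  by (simp add: res_part_def blinfun.sum_left)

text \<open>Both the pieces of \<open>x\<close> and their images are orthogonal families, so
  Pythagoras applies on each side. The bound is uniform in \<open>j\<close>, which makes the
  approximation in \<open>res_part_tendsto\<close> possible.\<close>

lemma norm_res_part_le:
  assumes j: "0 < j"
  shows "norm (res_part j T) \<le> norm T"
proof (rule norm_blinfun_bound)
  fix x
  have "(norm (res_part j T x))\<^sup>2 = (\<Sum>i<j. (norm (res_proj j (i + 1) (T (res_proj j i x))))\<^sup>2)"
    unfolding res_part_apply by (rule norm_sum_res_proj[OF j])
  also have "\<dots> \<le> (\<Sum>i<j. (norm T * norm (res_proj j i x))\<^sup>2)"
    by (intro sum_mono power_mono order_trans[OF norm_res_proj_le norm_blinfun]) simp
  also have "\<dots> = (norm T)\<^sup>2 * (\<Sum>i<j. (norm (res_proj j (i + 0) x))\<^sup>2)"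
    by (simp add: power_mult_distrib sum_distrib_left)
  also have "\<dots> = (norm T)\<^sup>2 * (norm (\<Sum>i<j. res_proj j (i + 0) x))\<^sup>2"
    by (simp only: norm_sum_res_proj[OF j])
  also have "(\<Sum>i<j. res_proj j (i + 0) x) = x"
    using arg_cong[OF sum_res_proj[OF j], of "\<lambda>S. S x"] by (simp add: blinfun.sum_left)
  finally show "norm (res_part j T x) \<le> norm T * norm x"
    by (intro power2_le_imp_le[of "norm (res_part j T x)"]) (simp_all add: power_mult_distrib)
qed simp

lemma res_part_diff: "res_part j (S - T) = res_part j S - res_part j T"
  by (rule blinfun_eqI) (simp add: res_part_apply blinfun.diff_left blinfun.diff_right sum_subtractf)

lemma entry_shift_diag_op:
  assumes "\<And>k. cmod (a k) \<le> B"
  shows "entry (shift o\<^sub>L diag_op a) k l = (if k = Suc l then a l else 0)"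
  by (auto simp: shift_compose_entry entry_diag_op[OF assms])

lemma res_part_in_bounded_ops: "T \<in> bounded_ops \<Longrightarrow> res_part j T \<in> bounded_ops"
proof -
  assume T: "T \<in> bounded_ops"
  have "res_proj j i \<in> bounded_ops" for i
    unfolding res_proj_def by (rule diag_op_in_bounded_ops[OF res_proj_bound])
  with T show ?thesis
    unfolding res_part_def
    by (intro star_subalgebra_sum[OF star_subalgebra_bounded_ops]
        star_subalgebraD(5)[OF star_subalgebra_bounded_ops])
qed

lemma entry_res_part:
  assumes j: "0 < j" and T: "T \<in> bounded_ops"
  shows "entry (res_part j T) k l = (if k mod j = Suc l mod j then entry T k l else 0)"
proof -
  have p: "res_proj j i (basis l) = (if i mod j = l mod j then basis l else 0)" for i
    by (rule ell2_eqI) (auto simp: coord_res_proj basis.rep_eq)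
  have "entry (res_part j T) k l =
      (\<Sum>i<j. coord (res_proj j (i + 1) (T (res_proj j i (basis l)))) k)"
    by (simp add: entry_def res_part_apply)
  also have "\<dots> = (\<Sum>i<j. if i = l mod j then (if k mod j = Suc i mod j then entry T k l else 0) else 0)"
    by (rule sum.cong) (auto simp: p coord_res_proj entry_def)
  also have "\<dots> = (if k mod j = Suc (l mod j) mod j then entry T k l else 0)"
    using j by simp
  finally show ?thesis by (simp add: mod_Suc_eq)
qed

text \<open>Inside the band \<open>k\<close> and \<open>Suc l\<close> differ by at most
  \<open>Suc M\<close>, hence by less than \<open>j\<close>. Congruence modulo \<open>j\<close> then
  forces equality, and only the first subdiagonal survives.\<close>

lemma res_part_band:
  assumes T: "T \<in> bounded_ops" "band_per M i L T" and j: "Suc M < j"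
  shows "res_part j T = shift o\<^sub>L diag_op (\<lambda>k. entry T (Suc k) k)"
proof (rule bounded_ops_entryI[OF res_part_in_bounded_ops[OF T(1)]])
  have B: "cmod (entry T (Suc k) k) \<le> norm T" for k by (rule norm_entry_le)
  show "shift o\<^sub>L diag_op (\<lambda>k. entry T (Suc k) k) \<in> bounded_ops"
    using star_subalgebraD(5)[OF star_subalgebra_bounded_ops shift_in_bounded_ops
        diag_op_in_bounded_ops[of "\<lambda>k. entry T (Suc k) k", OF B]] .
  fix k l
  have "k = Suc l" if e: "k mod j = Suc l mod j" "entry T k l \<noteq> 0"
  proof -
    have "\<not> l + M < k" "\<not> k + M < l" using T(2) e(2) unfolding band_per_def by blast+
    moreover have "k \<le> Suc l \<Longrightarrow> j dvd Suc l - k" "Suc l \<le> k \<Longrightarrow> j dvd k - Suc l"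
      using e(1) by (simp_all add: mod_eq_dvd_iff_nat flip: mod_eq_dvd_iff_nat)
    ultimately show ?thesis
      using j dvd_imp_le[of j "Suc l - k"] dvd_imp_le[of j "k - Suc l"] by linarith
  qed
  moreover have "0 < j" using j by simp
  ultimately show "entry (res_part j T) k l = entry (shift o\<^sub>L diag_op (\<lambda>k. entry T (Suc k) k)) k l"
    by (auto simp: entry_res_part T(1) entry_shift_diag_op[of "\<lambda>k. entry T (Suc k) k", OF B])
qed

lemma norm_shift_diag_op_le:
  assumes "\<And>k. cmod (a k) \<le> B"
  shows "norm (shift o\<^sub>L diag_op a) \<le> B"
proof -
  have "norm (shift o\<^sub>L diag_op a) \<le> norm shift * norm (diag_op a)" by (rule norm_blinfun_compose)
  also have "\<dots> \<le> 1 * B"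
    by (intro mult_mono norm_shift_le norm_diag_op_le assms) simp_all
  finally show ?thesis by simp
qed

lemma diag_op_diff:
  assumes "\<And>k. cmod (a k) \<le> A" "\<And>k. cmod (b k) \<le> B"
  shows "diag_op (\<lambda>k. a k - b k) = diag_op a - diag_op b"
proof -
  have "cmod (a k - b k) \<le> A + B" for k
    using norm_triangle_ineq4[of "a k" "b k"] assms(1)[of k] assms(2)[of k] by linarith
  then show ?thesis
    by (intro blinfun_eqI ell2_eqI)
      (simp add: blinfun.diff_left coord_diag_op[of _ "A + B"] coord_diag_op[OF assms(1)]
        coord_diag_op[OF assms(2)] left_diff_distrib)
qed

text \<open>For a banded approximant \<open>S\<close> the two sides agree as soon as
  \<open>j n\<close> exceeds the band. Both \<open>res_part\<close> and the extraction of the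
  subdiagonal are contractive, so replacing \<open>T\<close> by \<open>S\<close> costs at most twice
  the norm of \<open>T - S\<close>.\<close>

lemma res_part_tendsto:
  assumes T: "T \<in> BDT N" and j: "filterlim j at_top sequentially"
  shows "(\<lambda>n. res_part (j n) T) \<longlonglongrightarrow> (shift o\<^sub>L diag_op (\<lambda>k. entry T (Suc k) k))"
proof (rule tendstoI)
  fix e :: real assume "0 < e"
  then have "0 < e / 2" by simp
  then obtain S where S: "S \<in> band_periodic N" "norm (T - S) < e / 2"
    using BDT_approx[OF T] by blast
  then obtain M i L where SM: "S \<in> bounded_ops" "band_per M i L S"
    unfolding band_periodic_def by blast
  have B: "cmod (entry R (Suc k) k) \<le> norm R" for R k by (rule norm_entry_le)
  have "\<forall>\<^sub>F n in sequentially. M + 2 \<le> j n" using j unfolding filterlim_at_top by blast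
  then show "\<forall>\<^sub>F n in sequentially.
      dist (res_part (j n) T) (shift o\<^sub>L diag_op (\<lambda>k. entry T (Suc k) k)) < e"
  proof eventually_elim
    case (elim n)
    have "res_part (j n) T - (shift o\<^sub>L diag_op (\<lambda>k. entry T (Suc k) k)) =
        res_part (j n) (T - S) - (shift o\<^sub>L diag_op (\<lambda>k. entry (T - S) (Suc k) k))"
    proof -
      have "diag_op (\<lambda>k. entry (T - S) (Suc k) k) =
          diag_op (\<lambda>k. entry T (Suc k) k) - diag_op (\<lambda>k. entry S (Suc k) k)"
        unfolding entry_simps by (rule diag_op_diff[OF B B])
      moreover have "res_part (j n) S = shift o\<^sub>L diag_op (\<lambda>k. entry S (Suc k) k)"
        by (rule res_part_band[OF SM]) (use elim in simp)
      ultimately show ?thesis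
        by (simp add: res_part_diff bounded_bilinear.diff_right[OF bounded_bilinear_blinfun_compose])
    qed
    also have "norm \<dots> \<le> norm (T - S) + norm (T - S)"
      by (rule order_trans[OF norm_triangle_ineq4])
        (intro add_mono norm_res_part_le norm_shift_diag_op_le norm_entry_le; use elim in simp)
    finally show ?case using S(2) by (simp add: dist_norm)
  qed
qed

section \<open>Derivations\<close>

lemma BDT_bounded: "T \<in> BDT N \<Longrightarrow> T \<in> bounded_ops"
  by (rule star_subalgebraD(1)[OF star_subalgebra_BDT])

lemma BDT_alg_bounded: "T \<in> BDT_alg N \<Longrightarrow> T \<in> bounded_ops"
  by (rule star_subalgebraD(1)[OF star_subalgebra_BDT_alg])

lemma BDT_algD: "T \<in> BDT_alg N \<Longrightarrow> T \<in> BDT N"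
  using BDT_alg_subset_BDT by blast

lemma scaleC_op_eq_simps:
  "c \<cdot>\<^sub>C (S + T) = c \<cdot>\<^sub>C S + c \<cdot>\<^sub>C T"
  "c \<cdot>\<^sub>C (S - T) = c \<cdot>\<^sub>C S - c \<cdot>\<^sub>C T"
  "c \<cdot>\<^sub>C e \<cdot>\<^sub>C T = (c * e) \<cdot>\<^sub>C T"
  "c \<cdot>\<^sub>C (S o\<^sub>L R) = (c \<cdot>\<^sub>C S) o\<^sub>L R"
  by (intro blinfun_eqI ell2_eqI; simp add: blinfun.add_left blinfun.diff_left algebra_simps)+

lemma compose_scaleC_op: "S \<in> bounded_ops \<Longrightarrow> S o\<^sub>L (c \<cdot>\<^sub>C T) = c \<cdot>\<^sub>C (S o\<^sub>L T)"
  by (rule blinfun_eqI) (simp add: op_scale)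

lemma derivationD:
  assumes "derivation N d" "a \<in> BDT_alg N"
  shows "d a \<in> BDT N" "d (c \<cdot>\<^sub>C a) = c \<cdot>\<^sub>C d a"
    "b \<in> BDT_alg N \<Longrightarrow> d (a + b) = d a + d b"
    "b \<in> BDT_alg N \<Longrightarrow> d (a o\<^sub>L b) = (d a o\<^sub>L b) + (a o\<^sub>L d b)"
  using assms by (simp_all add: derivation_def)

lemma derivation_zero:
  assumes "derivation N d"
  shows "d 0 = 0"
  using derivationD(2)[OF assms star_subalgebraD(2)[OF star_subalgebra_BDT_alg], of 0]
  by (metis blinfun_eqI scaleC_op_apply ell2.scale_zero_left zero_blinfun.rep_eq)

lemma derivation_diff:
  assumes "derivation N d" "derivation N d'"
  shows "derivation N (\<lambda>a. d a - d' a)"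
  unfolding derivation_def
proof (intro conjI ballI allI)
  fix a b c assume a: "a \<in> BDT_alg N" and b: "b \<in> BDT_alg N"
  show "d a - d' a \<in> BDT N"
    using assms a by (intro star_subalgebra_diff[OF star_subalgebra_BDT]) (auto simp: derivationD)
  show "d (a + b) - d' (a + b) = d a - d' a + (d b - d' b)"
    by (simp add: derivationD(3)[OF assms(1) a b] derivationD(3)[OF assms(2) a b])
  show "d (c \<cdot>\<^sub>C a) - d' (c \<cdot>\<^sub>C a) = c \<cdot>\<^sub>C (d a - d' a)"
    by (simp add: derivationD(2)[OF assms(1) a] derivationD(2)[OF assms(2) a] scaleC_op_eq_simps)
  show "d (a o\<^sub>L b) - d' (a o\<^sub>L b) = ((d a - d' a) o\<^sub>L b) + (a o\<^sub>L (d b - d' b))"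
    by (rule blinfun_eqI) (simp add: derivationD(4)[OF assms(1) a b] derivationD(4)[OF assms(2) a b]
        blinfun.add_left blinfun.diff_left blinfun.diff_right)
qed

lemma derivation_scaleC:
  assumes d: "derivation N d"
  shows "derivation N (\<lambda>a. c \<cdot>\<^sub>C d a)"
  unfolding derivation_def
proof (intro conjI ballI allI)
  fix a b e assume a: "a \<in> BDT_alg N" and b: "b \<in> BDT_alg N"
  show "c \<cdot>\<^sub>C d a \<in> BDT N"
    by (rule star_subalgebraD(4)[OF star_subalgebra_BDT derivationD(1)[OF d a]])
  show "c \<cdot>\<^sub>C d (a + b) = c \<cdot>\<^sub>C d a + c \<cdot>\<^sub>C d b"
    by (simp add: derivationD(3)[OF d a b] scaleC_op_eq_simps)
  show "c \<cdot>\<^sub>C d (e \<cdot>\<^sub>C a) = e \<cdot>\<^sub>C c \<cdot>\<^sub>C d a"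
    by (simp add: derivationD(2)[OF d a] scaleC_op_eq_simps mult.commute)
  show "c \<cdot>\<^sub>C d (a o\<^sub>L b) = ((c \<cdot>\<^sub>C d a) o\<^sub>L b) + (a o\<^sub>L (c \<cdot>\<^sub>C d b))"
    by (simp add: derivationD(4)[OF d a b] scaleC_op_eq_simps compose_scaleC_op[OF BDT_alg_bounded[OF a]])
qed

lemma derivation_commutator:
  assumes x: "x \<in> BDT N"
  shows "derivation N (commutator x)"
  unfolding derivation_def
proof (intro conjI ballI allI)
  fix a b c assume a: "a \<in> BDT_alg N" and b: "b \<in> BDT_alg N"
  show "commutator x a \<in> BDT N"
    unfolding commutator_def
    by (intro star_subalgebra_diff[OF star_subalgebra_BDT] star_subalgebraD(5)[OF star_subalgebra_BDT]
        x BDT_algD[OF a])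
  show "commutator x (a + b) = commutator x a + commutator x b"
    by (rule blinfun_eqI) (simp add: commutator_def blinfun.add_left blinfun.diff_left blinfun.add_right)
  show "commutator x (c \<cdot>\<^sub>C a) = c \<cdot>\<^sub>C commutator x a"
    by (simp add: commutator_def scaleC_op_eq_simps compose_scaleC_op[OF BDT_bounded[OF x]])
  show "commutator x (a o\<^sub>L b) = (commutator x a o\<^sub>L b) + (a o\<^sub>L commutator x b)"
    by (rule blinfun_eqI) (simp add: commutator_def blinfun.add_left blinfun.diff_left blinfun.diff_right)
qed

lemma derivation_number_commutator: "derivation N number_commutator"
  unfolding derivation_def
proof (intro conjI ballI allI)
  fix a b c assume a: "a \<in> BDT_alg N" and b: "b \<in> BDT_alg N"
  note nc = number_commutator_BDT_alg(1)[OF a] number_commutator_BDT_alg(1)[OF b]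
  note span = preserves_span_BDT_alg[OF a] preserves_span_BDT_alg[OF b]
  show "number_commutator a \<in> BDT N" by (rule BDT_algD[OF number_commutator_BDT_alg(2)[OF a]])
  show "number_commutator (a + b) = number_commutator a + number_commutator b"
    using nc span
    by (intro has_number_commutator_unique)
      (auto simp: has_number_commutator_def blinfun.add_left preserves_span_def number_op_add)
  show "number_commutator (c \<cdot>\<^sub>C a) = c \<cdot>\<^sub>C number_commutator a"
    using nc span
    by (intro has_number_commutator_unique)
      (auto simp: has_number_commutator_def preserves_span_def number_op_scale
        ell2.scale_right_diff_distrib)
  show "number_commutator (a o\<^sub>L b) = (number_commutator a o\<^sub>L b) + (a o\<^sub>L number_commutator b)"
    using nc span
    by (intro has_number_commutator_unique)
      (auto simp: has_number_commutator_def blinfun.add_left blinfun.diff_right preserves_span_def)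
qed

lemma entry_number_commutator:
  assumes a: "a \<in> BDT_alg N"
  shows "entry (number_commutator a) k l = (of_nat k - of_nat l) * entry a k l"
proof -
  have "a (basis l) \<in> finite_span"
    using preserves_span_BDT_alg[OF a] basis_in_span unfolding preserves_span_def by blast
  then show ?thesis
    using number_commutator_BDT_alg(1)[OF a] basis_in_span[of l] BDT_alg_bounded[OF a]
    by (simp add: entry_def has_number_commutator_def number_op_basis op_scale coord_number_op
        left_diff_distrib)
qed

lemma number_commutator_in_bounded_ops:
  "a \<in> BDT_alg N \<Longrightarrow> number_commutator a \<in> bounded_ops"
  by (rule BDT_alg_bounded[OF number_commutator_BDT_alg(2)])

lemma number_commutator_shift: "number_commutator shift = shift"
  by (rule bounded_ops_entryI[OF number_commutator_in_bounded_ops[OF shift_in_BDT_alg] shift_in_bounded_ops])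
    (simp add: entry_number_commutator[OF shift_in_BDT_alg] entry_shift)

lemma number_commutator_diag_per:
  assumes T: "T \<in> diag_per N"
  shows "number_commutator T = 0"
proof -
  have A: "T \<in> BDT_alg N" using T diag_per_subset_BDT_alg by blast
  obtain a B where a: "T = diag_op a" "\<And>k. cmod (a k) \<le> B" using T by (blast elim: diag_per_E)
  show ?thesis
    by (rule bounded_ops_entryI[OF number_commutator_in_bounded_ops[OF A]])
      (simp_all add: entry_number_commutator[OF A] star_subalgebraD(2)[OF star_subalgebra_bounded_ops],
        simp add: a(1) entry_diag_op[OF a(2)])
qed

section \<open>Pointwise convergence of derivations, tested on generators\<close>

lemma tendsto_scaleC_op_zero: "X \<longlonglongrightarrow> 0 \<Longrightarrow> (\<lambda>n. c \<cdot>\<^sub>C X n) \<longlonglongrightarrow> 0"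
  by (rule Lim_null_comparison[OF always_eventually tendsto_mult_right_zero[of "\<lambda>n. norm (X n)" _ "cmod c"]])
    (auto simp: norm_scaleC_op_le tendsto_norm_zero)

text \<open>By linearity and the Leibniz rule, pointwise convergence to 0 passes to sums, scalar
  multiples and products, hence from the generators to all of \<open>BDT_alg N\<close>.\<close>

lemma derivations_tendsto_zero:
  assumes e: "\<And>n. derivation N (e n)"
    and U: "(\<lambda>n. e n shift) \<longlonglongrightarrow> 0" "(\<lambda>n. e n (adj shift)) \<longlonglongrightarrow> 0"
    and T: "\<And>T. T \<in> diag_per N \<Longrightarrow> (\<lambda>n. e n T) \<longlonglongrightarrow> 0"
    and a: "a \<in> BDT_alg N"
  shows "(\<lambda>n. e n a) \<longlonglongrightarrow> 0"
proof -
  note A = star_subalgebraD[OF star_subalgebra_BDT_alg[of N]]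
  \<comment> \<open>A derivation need not respect adjoints, so closure under \<open>adj\<close> is
    built into \<open>G\<close>.\<close>
  define G where "G = {a \<in> BDT_alg N. (\<lambda>n. e n a) \<longlonglongrightarrow> 0 \<and> (\<lambda>n. e n (adj a)) \<longlonglongrightarrow> 0}"
  have add: "(\<lambda>n. e n (a + b)) \<longlonglongrightarrow> 0" and mult: "(\<lambda>n. e n (a o\<^sub>L b)) \<longlonglongrightarrow> 0"
    if "a \<in> BDT_alg N" "b \<in> BDT_alg N" "(\<lambda>n. e n a) \<longlonglongrightarrow> 0" "(\<lambda>n. e n b) \<longlonglongrightarrow> 0" for a b
  proof -
    show "(\<lambda>n. e n (a + b)) \<longlonglongrightarrow> 0"
      using tendsto_add[OF that(3,4)] by (simp add: derivationD(3)[OF e that(1,2)])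
    have "(\<lambda>n. (e n a o\<^sub>L b) + (a o\<^sub>L e n b)) \<longlonglongrightarrow> (0 o\<^sub>L b) + (a o\<^sub>L 0)"
      by (intro tendsto_add bounded_bilinear.tendsto[OF bounded_bilinear_blinfun_compose] that tendsto_const)
    then show "(\<lambda>n. e n (a o\<^sub>L b)) \<longlonglongrightarrow> 0"
      by (simp add: derivationD(4)[OF e that(1,2)]
          bounded_bilinear.zero_left[OF bounded_bilinear_blinfun_compose]
          bounded_bilinear.zero_right[OF bounded_bilinear_blinfun_compose])
  qed
  have scale: "(\<lambda>n. e n (c \<cdot>\<^sub>C a)) \<longlonglongrightarrow> 0" if "a \<in> BDT_alg N" "(\<lambda>n. e n a) \<longlonglongrightarrow> 0" for c a
    using tendsto_scaleC_op_zero[OF that(2)] by (simp add: derivationD(2)[OF e that(1)])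
  have "star_subalgebra G"
    unfolding star_subalgebra_def
  proof (intro conjI ballI allI)
    show "G \<subseteq> bounded_ops" using A(1) by (auto simp: G_def)
    show "0 \<in> G" using A(2) by (simp add: G_def adj_zero derivation_zero[OF e])
    fix a b c assume a: "a \<in> G" and b: "b \<in> G"
    then have ab: "a \<in> BDT_alg N" "b \<in> BDT_alg N" "a \<in> bounded_ops" "b \<in> bounded_ops"
      using A(1) by (auto simp: G_def)
    show "a + b \<in> G" using a b add A(3,6) ab by (simp add: G_def adj_add)
    show "c \<cdot>\<^sub>C a \<in> G" using a scale A(4,6) ab by (simp add: G_def adj_scaleC)
    show "a o\<^sub>L b \<in> G" using a b mult A(5,6) ab by (simp add: G_def adj_compose)
    show "adj a \<in> G" using a A(6) ab by (simp add: G_def adj_adj)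
  qed
  moreover have "diag_per N \<subseteq> G"
  proof
    fix S assume S: "S \<in> diag_per N"
    then obtain a j where a: "S = diag_op a" "supernatural_dvd j N" "\<forall>k. a (k + j) = a k"
      unfolding diag_per_def by blast
    then obtain B where B: "\<And>k. cmod (a k) \<le> B" using periodic_bounded unfolding supernatural_dvd_def by blast
    have "adj S \<in> diag_per N"
      unfolding a(1) adj_diag_op[OF B] diag_per_def mem_Collect_eq
      using a(2,3) by (intro exI[of _ "\<lambda>k. cnj (a k)"] conjI refl exI[of _ j]) simp_all
    then show "S \<in> G" using S T diag_per_subset_BDT_alg by (auto simp: G_def)
  qed
  moreover have "shift \<in> G" "adj shift \<in> G"
    using U shift_in_BDT_alg adj_shift_in_BDT_alg by (simp_all add: G_def adj_adj[OF shift_in_bounded_ops])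
  ultimately have "BDT_alg N \<subseteq> G" unfolding BDT_alg_def by (intro hull_minimal) auto
  then show ?thesis using a by (auto simp: G_def)
qed

lemma id_in_BDT_alg: "id_blinfun \<in> BDT_alg N"
  using star_subalgebraD(5)[OF star_subalgebra_BDT_alg adj_shift_in_BDT_alg shift_in_BDT_alg]
  by (simp only: adj_shift_shift)

lemma derivation_id:
  assumes "derivation N d"
  shows "d id_blinfun = 0"
proof -
  have "d (id_blinfun o\<^sub>L id_blinfun) = d id_blinfun + d id_blinfun"
    unfolding derivationD(4)[OF assms id_in_BDT_alg id_in_BDT_alg] by (rule blinfun_eqI) (simp add: blinfun.add_left)
  moreover have "id_blinfun o\<^sub>L id_blinfun = (id_blinfun :: ell2 \<Rightarrow>\<^sub>L ell2)"
    by (rule blinfun_eqI) simp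
  ultimately show ?thesis by simp
qed

text \<open>Only the action on \<open>E\<^sub>0\<close> of the image of \<open>U\<^sup>*\<close> is not determined by the image of \<open>U\<close>
  through \<open>U\<^sup>* U = 1\<close>.\<close>

lemma norm_derivation_adj_shift_le:
  assumes d: "derivation N d"
  shows "norm (d (adj shift)) \<le> norm (d shift) + norm (d (adj shift) (basis 0))"
proof (rule norm_blinfun_bound)
  fix x
  let ?V = "adj shift"
  have V1: "norm (?V y) \<le> norm y" for y
    using norm_blinfun[of ?V y] mult_right_mono[of "norm ?V" 1 "norm y"]
      norm_adj_le[OF shift_in_bounded_ops] norm_shift_le by simp
  have dV: "d ?V \<in> bounded_ops"
    by (rule BDT_bounded[OF derivationD(1)[OF d adj_shift_in_BDT_alg]])
  \<comment> \<open>The range of the shift is the orthogonal complement of \<open>basis 0\<close>;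
    on that range the Leibniz rule for \<open>adj shift o\<^sub>L shift\<close> expresses
    \<open>d ?V\<close> through \<open>d shift\<close>.\<close>
  have "x = shift (?V x) + coord x 0 *\<^sub>C basis 0"
    by (rule ell2_eqI) (simp add: shift_fun.rep_eq coord_adj_shift basis.rep_eq split: nat.split)
  then have "d ?V x = d ?V (shift (?V x)) + coord x 0 *\<^sub>C d ?V (basis 0)"
    by (metis blinfun.add_right op_scale[OF dV])
  moreover have "d ?V (shift (?V x)) + ?V (d shift (?V x)) = 0"
    using arg_cong[OF derivationD(4)[OF d adj_shift_in_BDT_alg shift_in_BDT_alg], of "\<lambda>S. S (?V x)"]
    by (simp only: adj_shift_shift derivation_id[OF d] zero_blinfun.rep_eq blinfun.add_left
        blinfun_apply_blinfun_compose)
  ultimately have "d ?V x = coord x 0 *\<^sub>C d ?V (basis 0) - ?V (d shift (?V x))"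
    by (simp add: add_eq_0_iff2)
  then have "norm (d ?V x) \<le> norm (coord x 0 *\<^sub>C d ?V (basis 0)) + norm (?V (d shift (?V x)))"
    by (simp only: norm_triangle_ineq4)
  also have "norm (coord x 0 *\<^sub>C d ?V (basis 0)) \<le> norm x * norm (d ?V (basis 0))"
    unfolding norm_scaleC by (intro mult_right_mono norm_coord_le) simp
  also have "norm (?V (d shift (?V x))) \<le> norm (d shift) * norm x"
  proof -
    have "norm (?V (d shift (?V x))) \<le> norm (d shift (?V x))" by (rule V1)
    also have "\<dots> \<le> norm (d shift) * norm (?V x)" by (rule norm_blinfun)
    also have "\<dots> \<le> norm (d shift) * norm x" by (intro mult_left_mono V1) simp
    finally show ?thesis .
  qed
  finally show "norm (d ?V x) \<le> (norm (d shift) + norm (d ?V (basis 0))) * norm x"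
    by (simp add: algebra_simps)
qed simp

section \<open>Compensation by inner derivations\<close>

definition inner_part :: "((ell2 \<Rightarrow>\<^sub>L ell2) \<Rightarrow> (ell2 \<Rightarrow>\<^sub>L ell2)) \<Rightarrow> nat \<Rightarrow> (ell2 \<Rightarrow>\<^sub>L ell2)" where
  "inner_part d j = (\<Sum>i<j. d (res_proj j i) o\<^sub>L res_proj j i)"

definition compensated ::
  "((ell2 \<Rightarrow>\<^sub>L ell2) \<Rightarrow> (ell2 \<Rightarrow>\<^sub>L ell2)) \<Rightarrow> nat \<Rightarrow> (ell2 \<Rightarrow>\<^sub>L ell2) \<Rightarrow> (ell2 \<Rightarrow>\<^sub>L ell2)" where
  "compensated d j a = d a - commutator (inner_part d j) a"

lemma compensated_apply:
  "compensated d j a v = d a v - (inner_part d j (a v) - a (inner_part d j v))"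
  by (simp add: compensated_def commutator_def blinfun.diff_left)

context
  fixes N d j
  assumes d: "derivation N d" and j: "supernatural_dvd j N"
begin

abbreviation (input) "P \<equiv> res_proj j"
abbreviation (input) "D \<equiv> compensated d j"

lemma j_pos: "0 < j" using j by (simp add: supernatural_dvd_def)

lemma P_in: "P i \<in> BDT_alg N" by (rule res_proj_in_BDT_alg[OF j])

lemma inner_part_in_BDT: "inner_part d j \<in> BDT N"
  unfolding inner_part_def
  by (intro star_subalgebra_sum[OF star_subalgebra_BDT] star_subalgebraD(5)[OF star_subalgebra_BDT]
      derivationD(1)[OF d] P_in BDT_algD)

lemma derivation_D: "derivation N D"
  unfolding compensated_def[abs_def]
  by (intro derivation_diff d derivation_commutator inner_part_in_BDT)

text \<open>The Leibniz rule for the product of \<open>P k\<close> and \<open>P i\<close> moves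
  \<open>d\<close> from \<open>P i\<close> to \<open>P k\<close>. The factor \<open>d (P k)\<close>
  no longer depends on \<open>i\<close>, so the sum over \<open>i\<close> can be evaluated.\<close>

lemma P_dP:
  assumes "i < j" "k < j"
  shows "P k (d (P i) (P i v)) = (if i = k then d (P k) (P k v) else 0) - d (P k) (P i v)"
proof -
  have 1: "d (P k o\<^sub>L P i) (P i v) = d (P k) (P i v) + P k (d (P i) (P i v))"
    by (simp add: derivationD(4)[OF d P_in P_in] blinfun.add_left)
  have 2: "P k o\<^sub>L P i = (if i = k then P k else 0)"
    using assms by (intro blinfun_eqI) (simp add: res_proj_orthogonal)
  show ?thesis
    using 1 unfolding 2 by (cases "i = k") (simp_all add: derivation_zero[OF d] eq_neg_iff_add_eq_0 add.commute)
qed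

lemma sum_P: "(\<Sum>i<j. P i v) = v"
  using arg_cong[OF sum_res_proj[OF j_pos], of "\<lambda>S. S v"] by (simp add: blinfun.sum_left)

lemma inner_part_P:
  assumes k: "k < j"
  shows "inner_part d j (P k v) = d (P k) (P k v)"
proof -
  have "inner_part d j (P k v) = (\<Sum>i<j. if i = k then d (P k) (P k v) else 0)"
    unfolding inner_part_def blinfun.sum_left
    by (rule sum.cong) (use k in \<open>auto simp: res_proj_orthogonal\<close>)
  then show ?thesis using k by simp
qed

lemma P_inner_part:
  assumes k: "k < j"
  shows "P k (inner_part d j v) = d (P k) (P k v) - d (P k) v"
proof -
  have "P k (inner_part d j v) = (\<Sum>i<j. P k (d (P i) (P i v)))"
    by (simp add: inner_part_def blinfun.sum_left blinfun.sum_right)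
  also have "\<dots> = (\<Sum>i<j. (if i = k then d (P k) (P k v) else 0) - d (P k) (P i v))"
    by (rule sum.cong) (use k P_dP in auto)
  also have "\<dots> = d (P k) (P k v) - d (P k) (\<Sum>i<j. P i v)"
    using k by (simp add: sum_subtractf blinfun.sum_right)
  finally show ?thesis by (simp only: sum_P)
qed

text \<open>Write \<open>x\<close> for \<open>inner_part d j\<close>. By the two preceding lemmas
  \<open>x\<close> after \<open>P k\<close> is \<open>d (P k)\<close> after \<open>P k\<close>, and
  \<open>P k\<close> after \<open>x\<close> is the same operator minus \<open>d (P k)\<close>; so
  the commutator of \<open>x\<close> with \<open>P k\<close> is \<open>d (P k)\<close>.\<close>

lemma D_P: "D (P k) = 0"
proof -
  have "D (P k) = 0" if "k < j" for k
    by (rule blinfun_eqI)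
      (simp add: compensated_apply inner_part_P[OF that] P_inner_part[OF that])
  from this[of "k mod j"] show ?thesis using j_pos by (simp add: res_proj_mod)
qed

text \<open>The inner part has no diagonal blocks. Hence subtracting its commutator does not change
  the blocks of \<open>d shift\<close> that \<open>res_part\<close> retains.\<close>

lemma P_inner_part_P: "P k (inner_part d j (P k v)) = 0"
proof -
  have "P k (inner_part d j (P k v)) = 0" if "k < j" for k
    by (simp add: P_inner_part[OF that])
  from this[of "k mod j"] show ?thesis using j_pos by (simp add: res_proj_mod)
qed

lemma D_compose_P:
  assumes "a \<in> BDT_alg N"
  shows "D (a o\<^sub>L P i) = D a o\<^sub>L P i" "D (P i o\<^sub>L a) = P i o\<^sub>L D a"
  unfolding derivationD(4)[OF derivation_D assms P_in] derivationD(4)[OF derivation_D P_in assms] D_P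
  by (rule blinfun_eqI, simp add: blinfun.add_left)+

text \<open>Since \<open>D\<close> kills the projections, \<open>D shift\<close> intertwines
  \<open>P i\<close> with \<open>P (Suc i)\<close> just as \<open>shift\<close> does, so only the
  blocks from class \<open>i\<close> to class \<open>i + 1\<close> remain. In them both terms of the
  commutator reduce to diagonal blocks of the inner part, which vanish.\<close>

lemma D_shift: "D shift = res_part j (d shift)"
proof (rule blinfun_eqI)
  fix v
  have "D shift (P i v) = P (i + 1) (d shift (P i v))" for i
  proof -
    have "D shift o\<^sub>L P i = P (Suc i) o\<^sub>L D shift"
      by (simp only: shift_res_proj flip: D_compose_P[OF shift_in_BDT_alg])
    from arg_cong[OF this, of "\<lambda>S. S (P i v)"]
    have "D shift (P i v) = P (Suc i) (D shift (P i v))" by simp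
    also have "\<dots> = P (Suc i) (d shift (P i v)) -
        (P (Suc i) (inner_part d j (shift (P i v))) - P (Suc i) (shift (inner_part d j (P i v))))"
      by (simp add: compensated_apply blinfun.diff_right)
    also have "shift (P i v) = P (Suc i) (shift v)"
      using arg_cong[OF shift_res_proj[of j i], of "\<lambda>S. S v"] by simp
    also have "P (Suc i) (shift (inner_part d j (P i v))) = shift (P i (inner_part d j (P i v)))"
      using arg_cong[OF shift_res_proj[of j i], of "\<lambda>S. S (inner_part d j (P i v))"] by simp
    finally show ?thesis by (simp only: P_inner_part_P blinfun.zero_right diff_zero Suc_eq_plus1)
  qed
  then have "D shift (\<Sum>i<j. P i v) = res_part j (d shift) v"
    by (simp only: blinfun.sum_right res_part_apply)
  then show "D shift v = res_part j (d shift) v" by (simp only: sum_P)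
qed

text \<open>The block argument of \<open>D_shift\<close> for \<open>adj shift\<close>, from class 0
  to class \<open>j - 1\<close>. The latter class starts at index \<open>j - 1\<close>, so the
  right-hand side tends to 0 as \<open>j\<close> grows.\<close>

lemma D_adj_shift_basis_0: "D (adj shift) (basis 0) = P (j - 1) (d (adj shift) (basis 0))"
proof -
  let ?V = "adj shift"
  \<comment> \<open>Class 0 is named \<open>Suc (j - 1)\<close>, so that its cyclic predecessor is
    visibly \<open>j - 1\<close>.\<close>
  have P0: "P (Suc (j - 1)) (basis 0) = basis 0"
    by (rule ell2_eqI) (use j_pos in \<open>auto simp: coord_res_proj basis.rep_eq\<close>)
  have VP: "?V (P (Suc (j - 1)) y) = P (j - 1) (?V y)" for y
    using arg_cong[OF adj_shift_res_proj[of j "j - 1"], of "\<lambda>S. S y"] by simp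
  have "D ?V o\<^sub>L P (Suc (j - 1)) = P (j - 1) o\<^sub>L D ?V"
    by (simp only: adj_shift_res_proj flip: D_compose_P[OF adj_shift_in_BDT_alg])
  from arg_cong[OF this, of "\<lambda>S. S (basis 0)"]
  have "D ?V (basis 0) = P (j - 1) (D ?V (basis 0))" by (simp only: blinfun_apply_blinfun_compose P0)
  also have "\<dots> = P (j - 1) (d ?V (basis 0)) -
      (P (j - 1) (inner_part d j (?V (basis 0))) - P (j - 1) (?V (inner_part d j (basis 0))))"
    by (simp only: compensated_apply blinfun.diff_right)
  also have "?V (basis 0) = 0" by (simp add: adj_shift_basis)
  also have "P (j - 1) (?V (inner_part d j (basis 0))) =
      ?V (P (Suc (j - 1)) (inner_part d j (P (Suc (j - 1)) (basis 0))))"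
    by (simp only: VP P0)
  finally show ?thesis by (simp only: P_inner_part_P blinfun.zero_right diff_zero)
qed

text \<open>On each residue class modulo \<open>j\<close> the operator is a scalar: composed with
  \<open>P i\<close> it is \<open>a i \<cdot>\<^sub>C P i\<close>, which \<open>D\<close>
  kills.\<close>

lemma D_diag_per:
  assumes a: "\<And>k. a (k + i) = a k" "i dvd j"
  shows "D (diag_op a) = 0"
proof -
  obtain c where c: "j = i * c" using a(2) by blast
  have per: "a (k + n * i) = a k" for k n
  proof (induction n)
    case (Suc n)
    have "a (k + Suc n * i) = a ((k + n * i) + i)" by (simp add: ac_simps)
    then show ?case by (simp only: a(1) Suc)
  qed simp
  have amod: "a k = a (k mod j)" for k
  proof -
    define q where "q = k div j"
    have "k = k mod j + q * j" by (simp add: q_def)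
    also have "q * j = (q * c) * i" using c by simp
    finally show ?thesis by (metis per)
  qed
  have per': "\<forall>k. a (k + j) = a k" using amod by (metis mod_add_self2)
  obtain B where B: "\<And>k. cmod (a k) \<le> B" using periodic_bounded[OF j_pos per'] by blast
  have T: "diag_op a \<in> BDT_alg N"
    using diag_per_subset_BDT_alg j per' unfolding diag_per_def by blast
  have TP: "diag_op a o\<^sub>L P i = a i \<cdot>\<^sub>C P i" if "i < j" for i
    by (rule blinfun_eqI, rule ell2_eqI)
      (use that amod in \<open>auto simp: coord_diag_op[OF B] coord_res_proj\<close>)
  have "D (diag_op a) (P i v) = 0" if "i < j" for i v
  proof -
    have "D (diag_op a) o\<^sub>L P i = D (a i \<cdot>\<^sub>C P i)"
      by (simp only: TP[OF that, symmetric] D_compose_P(1)[OF T])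
    also have "\<dots> = a i \<cdot>\<^sub>C D (P i)" by (rule derivationD(2)[OF derivation_D P_in])
    also have "\<dots> = 0" unfolding D_P by (rule blinfun_eqI) simp
    finally show ?thesis by (metis blinfun_apply_blinfun_compose zero_blinfun.rep_eq)
  qed
  then have "D (diag_op a) (\<Sum>i<j. P i v) = 0" for v by (simp add: blinfun.sum_right)
  then show ?thesis unfolding sum_P by (intro blinfun_eqI) simp
qed

end

section \<open>Approximate innerness\<close>

text \<open>The class of \<open>j n - 1\<close> has no member below \<open>j n - 1\<close>, so its
  projection eventually annihilates every finite truncation of \<open>v\<close>. Contractivity
  handles the tail.\<close>

lemma res_proj_last_tendsto_zero:
  assumes j: "filterlim j at_top sequentially"
  shows "(\<lambda>n. res_proj (j n) (j n - 1) v) \<longlonglongrightarrow> 0"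
proof (rule tendstoI)
  fix e :: real assume "0 < e"
  let ?t = "\<lambda>K. \<Sum>k<K. coord v k *\<^sub>C basis k"
  have "\<forall>\<^sub>F K in sequentially. dist (?t K) v < e" using trunc_tendsto \<open>0 < e\<close> by (rule tendstoD)
  then obtain K where K: "dist (?t K) v < e" by (auto simp: eventually_sequentially)
  have "\<forall>\<^sub>F n in sequentially. Suc K \<le> j n" using j unfolding filterlim_at_top by blast
  then show "\<forall>\<^sub>F n in sequentially. dist (res_proj (j n) (j n - 1) v) 0 < e"
  proof eventually_elim
    case (elim n)
    have "res_proj (j n) (j n - 1) (?t K) = 0"
      by (rule ell2_eqI) (use elim in \<open>auto simp: coord_res_proj basis_trunc simp del: coord_sum\<close>)
    then have "res_proj (j n) (j n - 1) v = res_proj (j n) (j n - 1) (v - ?t K)"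
      by (simp only: blinfun.diff_right diff_zero)
    then have "norm (res_proj (j n) (j n - 1) v) \<le> norm (v - ?t K)"
      by (simp only: norm_res_proj_le)
    also have "\<dots> < e" using K by (simp only: dist_norm norm_minus_commute)
    finally show ?case by simp
  qed
qed

text \<open>The subdiagonal of a banded approximant \<open>S\<close> is eventually periodic, hence
  exactly the increments of an eventually periodic \<open>b\<close> plus a constant. The error is an
  entry of \<open>T - S\<close>.\<close>

lemma subdiagonal_antidifference:
  assumes T: "T \<in> BDT N" and e: "0 < e"
  obtains b c B where "diag_op b \<in> BDT N" "\<And>k. cmod (b k) \<le> B"
    "\<And>k. cmod (entry T (Suc k) k - (b (Suc k) - b k) - c) \<le> e"
proof -
  obtain S where S: "S \<in> band_periodic N" "norm (T - S) < e" using BDT_approx[OF T e] .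
  then obtain M j L where SM: "supernatural_dvd j N" "band_per M j L S"
    unfolding band_periodic_def by blast
  have j: "0 < j" using SM(1) by (simp add: supernatural_dvd_def)
  define h where "h k = entry S (Suc k) k" for k
  have "h (k + j) = h k" if "L \<le> k" for k
  proof -
    have "entry S (Suc k + j) (k + j) = entry S (Suc k) k"
      using SM(2) that unfolding band_per_def by (meson le_SucI)
    then show ?thesis by (simp add: h_def)
  qed
  then obtain b c where b: "\<And>k. L \<le> k \<Longrightarrow> b (k + j) = b k" and h: "\<And>k. h k = b (Suc k) - b k + c"
    using ev_periodic_antidifference[OF j, of L h] by blast
  obtain B where B: "\<And>k. cmod (b k) \<le> B" using ev_periodic_bounded[of j L b] j b by blast
  have "cmod (entry T (Suc k) k - (b (Suc k) - b k) - c) \<le> e" for k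
  proof -
    have eq: "entry T (Suc k) k - (b (Suc k) - b k) - c = entry (T - S) (Suc k) k"
      using h[of k] by (simp add: h_def)
    show ?thesis unfolding eq by (rule order_trans[OF norm_entry_le less_imp_le[OF S(2)]])
  qed
  moreover have "diag_op b \<in> BDT N"
    by (rule BDT_algD[OF diag_op_ev_periodic_in_BDT_alg[where a = b, OF SM(1)]]) (rule b)
  ultimately show ?thesis using B by (intro that)
qed

lemma entry_commutator_shift:
  "entry (commutator T shift) (Suc k) k = entry T (Suc k) (Suc k) - entry T k k"
  by (simp add: commutator_def shift_compose_entry)

lemma commutator_add_left: "commutator (S + T) a = commutator S a + commutator T a"
  by (rule blinfun_eqI) (simp add: commutator_def blinfun.add_left blinfun.diff_left blinfun.add_right)

lemma commutator_diag_op_diag_per: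
  assumes b: "\<And>k. cmod (b k) \<le> B" and T: "T \<in> diag_per N"
  shows "commutator (diag_op b) T = 0"
proof -
  obtain a A where a: "T = diag_op a" "\<And>k. cmod (a k) \<le> A" using T by (blast elim: diag_per_E)
  show ?thesis
    by (rule blinfun_eqI, rule ell2_eqI)
      (simp add: commutator_def blinfun.diff_left a(1) coord_diag_op[OF a(2)] coord_diag_op[OF b])
qed

text \<open>The commutator of \<open>diag_op b\<close> with the shift is the shift after the
  diagonal of increments of \<open>b\<close>. The whole expression is therefore the shift after one
  diagonal operator, and a bound on its sequence suffices.\<close>

lemma norm_shift_error_le:
  assumes g: "\<And>k. cmod (g k) \<le> G" and b: "\<And>k. cmod (b k) \<le> B"
    and e: "\<And>k. cmod (g k - (b (Suc k) - b k) - c) \<le> e"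
  shows "norm ((shift o\<^sub>L diag_op g) - c' \<cdot>\<^sub>C shift - commutator (diag_op b) shift) \<le> e + cmod (c - c')"
proof -
  note A = star_subalgebraD[OF star_subalgebra_bounded_ops]
  note diff = star_subalgebra_diff[OF star_subalgebra_bounded_ops]
  let ?f = "\<lambda>k. g k - (b (Suc k) - b k) - c'"
  have f: "cmod (?f k) \<le> e + cmod (c - c')" for k
  proof -
    have eq: "?f k = (g k - (b (Suc k) - b k) - c) + (c - c')" by simp
    show ?thesis unfolding eq by (rule order_trans[OF norm_triangle_ineq add_right_mono[OF e]])
  qed
  have "(shift o\<^sub>L diag_op g) - c' \<cdot>\<^sub>C shift - commutator (diag_op b) shift = shift o\<^sub>L diag_op ?f"
  proof (rule bounded_ops_entryI)
    show "(shift o\<^sub>L diag_op g) - c' \<cdot>\<^sub>C shift - commutator (diag_op b) shift \<in> bounded_ops"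
      unfolding commutator_def
      by (intro diff A(4,5) shift_in_bounded_ops diag_op_in_bounded_ops[OF g] diag_op_in_bounded_ops[OF b])
    show "shift o\<^sub>L diag_op ?f \<in> bounded_ops"
      by (intro A(5) shift_in_bounded_ops diag_op_in_bounded_ops[of ?f, OF f])
    show "entry ((shift o\<^sub>L diag_op g) - c' \<cdot>\<^sub>C shift - commutator (diag_op b) shift) k l =
        entry (shift o\<^sub>L diag_op ?f) k l" for k l
      by (auto simp: commutator_def entry_shift_diag_op[OF g] entry_shift_diag_op[OF b] entry_shift
          entry_shift_diag_op[of ?f, OF f] shift_compose_entry(2) entry_diag_op[OF b])
  qed
  then show ?thesis using norm_shift_diag_op_le[of ?f, OF f] by simp
qed

lemma derivation_decomposition:
  assumes N: "\<not> supernatural_finite N" and d: "derivation N d"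
  obtains C where "approximately_inner N (\<lambda>a. d a - C \<cdot>\<^sub>C number_commutator a)"
proof -
  define g where "g k = entry (d shift) (Suc k) k" for k
  have dU: "d shift \<in> BDT N" by (rule derivationD(1)[OF d shift_in_BDT_alg])
  have g: "cmod (g k) \<le> norm (d shift)" for k unfolding g_def by (rule norm_entry_le)
  let ?e = "\<lambda>n. 1 / real (Suc n)"
  have "\<forall>n. \<exists>b c B. diag_op b \<in> BDT N \<and> (\<forall>k. cmod (b k) \<le> B) \<and>
      (\<forall>k. cmod (g k - (b (Suc k) - b k) - c) \<le> ?e n)"
  proof
    fix n
    have "0 < ?e n" by simp
    from subdiagonal_antidifference[OF dU this] show "\<exists>b c B. diag_op b \<in> BDT N \<and> (\<forall>k. cmod (b k) \<le> B) \<and>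
        (\<forall>k. cmod (g k - (b (Suc k) - b k) - c) \<le> ?e n)"
      unfolding g_def by metis
  qed
  then obtain b c B where b: "\<And>n. diag_op (b n) \<in> BDT N" "\<And>n k. cmod (b n k) \<le> B n"
    and gb: "\<And>n k. cmod (g k - (b n (Suc k) - b n k) - c n) \<le> ?e n"
    unfolding choice_iff by blast
  \<comment> \<open>Two approximations of the same \<open>g\<close> differ by the increments of the
    bounded sequence \<open>b m - b n\<close> plus \<open>c m - c n\<close>, so the means must be
    close.\<close>
  have cc: "cmod (c m - c n) \<le> ?e n + ?e m" for m n
  proof (rule norm_le_of_bounded_antidifference[of "\<lambda>k. b m k - b n k" "B m + B n"])
    fix k
    show "cmod (b m k - b n k) \<le> B m + B n"
      by (rule order_trans[OF norm_triangle_ineq4 add_mono[OF b(2) b(2)]])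
    have eq: "(b m (Suc k) - b n (Suc k)) - (b m k - b n k) + (c m - c n) =
        (g k - (b n (Suc k) - b n k) - c n) - (g k - (b m (Suc k) - b m k) - c m)"
      by simp
    show "cmod ((b m (Suc k) - b n (Suc k)) - (b m k - b n k) + (c m - c n)) \<le> ?e n + ?e m"
      unfolding eq by (rule order_trans[OF norm_triangle_ineq4 add_mono[OF gb gb]])
  qed
  have e0: "?e \<longlonglongrightarrow> 0" by (rule LIMSEQ_Suc[OF lim_const_over_n])
  have "Cauchy c"
  proof (rule metric_CauchyI)
    fix r :: real assume "0 < r"
    then have "\<forall>\<^sub>F n in sequentially. dist (?e n) 0 < r / 2" by (intro tendstoD[OF e0]) simp
    then obtain M where M: "\<And>n. n \<ge> M \<Longrightarrow> ?e n < r / 2" by (auto simp: eventually_sequentially)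
    have "dist (c m) (c n) < r" if "m \<ge> M" "n \<ge> M" for m n
      using cc[of m n] M[OF that(1)] M[OF that(2)] unfolding dist_norm by linarith
    then show "\<exists>M. \<forall>m\<ge>M. \<forall>n\<ge>M. dist (c m) (c n) < r" by blast
  qed
  then obtain C where C: "c \<longlonglongrightarrow> C" using Cauchy_convergent convergent_def by blast
  obtain j where j: "\<And>n. supernatural_dvd (j n) N"
    "\<And>i. supernatural_dvd i N \<Longrightarrow> \<forall>\<^sub>F n in sequentially. i dvd j n"
    "filterlim j at_top sequentially"
    by (rule supernatural_dvd_cofinal[OF N]) (rule that)
  \<comment> \<open>The first summand reduces \<open>d shift\<close> to diagonals congruent to the
    subdiagonal. The second cancels, up to a small error, the deviation of the subdiagonal from its
    mean.\<close>
  define s where "s n = inner_part d (j n) + diag_op (b n)" for n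
  have s: "s n \<in> BDT N" for n
    unfolding s_def by (intro star_subalgebraD(3)[OF star_subalgebra_BDT] inner_part_in_BDT d j b)
  define d' where "d' a = d a - C \<cdot>\<^sub>C number_commutator a" for a
  define r where "r n a = d' a - commutator (s n) a" for n a
  have d': "derivation N d'"
    unfolding d'_def[abs_def] by (intro derivation_diff d derivation_scaleC derivation_number_commutator)
  have r: "derivation N (r n)" for n
    unfolding r_def[abs_def] by (intro derivation_diff d' derivation_commutator s)
  have r_eq: "r n a = compensated d (j n) a - C \<cdot>\<^sub>C number_commutator a - commutator (diag_op (b n)) a" for n a
    by (simp add: r_def d'_def s_def commutator_add_left compensated_def)
  have shift: "(\<lambda>n. r n shift) \<longlonglongrightarrow> 0"
  proof -
    let ?g = "shift o\<^sub>L diag_op g"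
    have eq: "r n shift = (res_part (j n) (d shift) - ?g) +
        (?g - C \<cdot>\<^sub>C shift - commutator (diag_op (b n)) shift)" for n
      by (simp add: r_eq D_shift[OF d j(1)] number_commutator_shift)
    have "(\<lambda>n. res_part (j n) (d shift) - ?g) \<longlonglongrightarrow> 0"
      using res_part_tendsto[OF dU j(3)] unfolding g_def[symmetric] by (rule LIM_zero)
    moreover have "(\<lambda>n. ?g - C \<cdot>\<^sub>C shift - commutator (diag_op (b n)) shift) \<longlonglongrightarrow> 0"
    proof (rule Lim_null_comparison)
      show "\<forall>\<^sub>F n in sequentially. norm (?g - C \<cdot>\<^sub>C shift - commutator (diag_op (b n)) shift) \<le>
          ?e n + cmod (c n - C)"
        by (intro always_eventually allI norm_shift_error_le[OF g b(2)] gb)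
      show "(\<lambda>n. ?e n + cmod (c n - C)) \<longlonglongrightarrow> 0"
        using tendsto_add[OF e0 tendsto_norm_zero[OF LIM_zero[OF C]]] by simp
    qed
    ultimately show ?thesis unfolding eq by (rule tendsto_add_zero)
  qed
  moreover have "(\<lambda>n. r n (adj shift)) \<longlonglongrightarrow> 0"
  proof (rule Lim_null_comparison)
    let ?V = "adj shift"
    show "\<forall>\<^sub>F n in sequentially. norm (r n ?V) \<le> norm (r n shift) + norm (r n ?V (basis 0))"
      by (intro always_eventually allI norm_derivation_adj_shift_le[OF r])
    \<comment> \<open>\<open>adj shift\<close> kills \<open>basis 0\<close>, and so do its
      commutators with the number operator and with \<open>diag_op (b n)\<close>; only the
      compensated term is left.\<close>
    have "r n ?V (basis 0) = res_proj (j n) (j n - 1) (d ?V (basis 0))" for n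
    proof -
      have "number_commutator ?V (basis 0) = 0"
        by (rule ell2_eqI) (simp add: entry_number_commutator[OF adj_shift_in_BDT_alg, unfolded entry_def]
            adj_shift_basis)
      moreover have "commutator (diag_op (b n)) ?V (basis 0) = 0"
        by (rule ell2_eqI)
          (simp add: commutator_def blinfun.diff_left adj_shift_basis coord_adj_shift coord_diag_op[OF b(2)]
            basis.rep_eq)
      ultimately show ?thesis
        by (simp add: r_eq blinfun.diff_left D_adj_shift_basis_0[OF d j(1)])
    qed
    then have "(\<lambda>n. r n ?V (basis 0)) \<longlonglongrightarrow> 0" by (simp only: res_proj_last_tendsto_zero[OF j(3)])
    then show "(\<lambda>n. norm (r n shift) + norm (r n ?V (basis 0))) \<longlonglongrightarrow> 0"
      by (intro tendsto_add_zero tendsto_norm_zero shift)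
  qed
  moreover have "(\<lambda>n. r n T) \<longlonglongrightarrow> 0" if T: "T \<in> diag_per N" for T
  proof -
    obtain a i where a: "T = diag_op a" "supernatural_dvd i N" "\<And>k. a (k + i) = a k"
      using T unfolding diag_per_def by blast
    \<comment> \<open>Once \<open>j n\<close> is a multiple of the period of \<open>T\<close>, all
      three terms of \<open>r n T\<close> vanish.\<close>
    have "\<forall>\<^sub>F n in sequentially. r n T = 0"
      using j(2)[OF a(2)]
    proof eventually_elim
      case (elim n)
      have "compensated d (j n) T = 0" unfolding a(1) using d j(1) a(3) elim by (rule D_diag_per)
      then show ?case
        using commutator_diag_op_diag_per[of "b n", OF b(2) T]
        by (intro blinfun_eqI) (simp add: r_eq number_commutator_diag_per[OF T] blinfun.minus_left)
    qed
    then show ?thesis by (rule tendsto_eventually)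
  qed
  ultimately have lim: "(\<lambda>n. r n a) \<longlonglongrightarrow> 0" if "a \<in> BDT_alg N" for a
    using derivations_tendsto_zero[of N r, OF r] that by blast
  have "(\<lambda>n. commutator (s n) a) \<longlonglongrightarrow> d' a" if "a \<in> BDT_alg N" for a
    using tendsto_diff[OF tendsto_const[of "d' a"] lim[OF that]] by (simp add: r_def)
  then have "approximately_inner N d'" unfolding approximately_inner_def using s by blast
  then show ?thesis unfolding d'_def by (rule that)
qed

text \<open>The commutators of \<open>s n - t n\<close> with \<open>shift\<close> tend to
  \<open>(C2 - C1) \<cdot>\<^sub>C shift\<close>. Their subdiagonal entries are increments of the
  bounded diagonal of \<open>s n - t n\<close>, and such increments cannot stay close to a nonzero
  constant.\<close>

lemma number_commutator_coefficient_unique: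
  assumes d: "approximately_inner N d1" "approximately_inner N d2"
    and eq: "C1 \<cdot>\<^sub>C number_commutator shift + d1 shift = C2 \<cdot>\<^sub>C number_commutator shift + d2 shift"
  shows "C1 = C2"
proof -
  obtain s t where s: "(\<lambda>n. commutator (s n) shift) \<longlonglongrightarrow> d1 shift"
    and t: "(\<lambda>n. commutator (t n) shift) \<longlonglongrightarrow> d2 shift"
    using d shift_in_BDT_alg unfolding approximately_inner_def by metis
  have le: "cmod (C1 - C2) \<le> e" if e: "0 < e" for e
  proof -
    have "(\<lambda>n. commutator (s n) shift - commutator (t n) shift) \<longlonglongrightarrow> d1 shift - d2 shift"
      using s t by (rule tendsto_diff)
    from tendstoD[OF this e] obtain n where
      n: "norm (commutator (s n) shift - commutator (t n) shift - (d1 shift - d2 shift)) < e"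
      by (auto simp: eventually_sequentially dist_norm)
    show ?thesis
    proof (rule norm_le_of_bounded_antidifference[of "\<lambda>k. entry (s n) k k - entry (t n) k k" "norm (s n) + norm (t n)"])
      fix k
      show "cmod (entry (s n) k k - entry (t n) k k) \<le> norm (s n) + norm (t n)"
        by (rule order_trans[OF norm_triangle_ineq4 add_mono[OF norm_entry_le norm_entry_le]])
      have "C1 + entry (d1 shift) (Suc k) k = C2 + entry (d2 shift) (Suc k) k"
        using arg_cong[OF eq, of "\<lambda>T. entry T (Suc k) k"] by (simp add: number_commutator_shift entry_shift)
      then have "entry (s n) (Suc k) (Suc k) - entry (t n) (Suc k) (Suc k) -
          (entry (s n) k k - entry (t n) k k) + (C1 - C2) =
          entry (commutator (s n) shift - commutator (t n) shift - (d1 shift - d2 shift)) (Suc k) k"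
        by (simp add: entry_commutator_shift algebra_simps)
      then show "cmod (entry (s n) (Suc k) (Suc k) - entry (t n) (Suc k) (Suc k) -
          (entry (s n) k k - entry (t n) k k) + (C1 - C2)) \<le> e"
        using norm_entry_le[of "commutator (s n) shift - commutator (t n) shift - (d1 shift - d2 shift)" "Suc k" k]
          n by simp
    qed
  qed
  have "cmod (C1 - C2) \<le> 0" by (rule dense_ge) (rule le)
  then show ?thesis by simp
qed

theorem theorem4p3:
  fixes N :: supernatural
    and d :: "(ell2 \<Rightarrow>\<^sub>L ell2) \<Rightarrow> (ell2 \<Rightarrow>\<^sub>L ell2)"
  assumes "\<not> supernatural_finite N"
    and "derivation N d"
  shows "\<exists>!C :: complex. \<exists>d'. derivation N d' \<and> approximately_inner N d' \<and>
           (\<forall>a\<in>BDT_alg N. d a = C \<cdot>\<^sub>C number_commutator a + d' a)"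
proof (rule ex_ex1I)
  obtain C where "approximately_inner N (\<lambda>a. d a - C \<cdot>\<^sub>C number_commutator a)"
    using derivation_decomposition[OF assms] .
  moreover have "derivation N (\<lambda>a. d a - C \<cdot>\<^sub>C number_commutator a)"
    by (intro derivation_diff assms derivation_scaleC derivation_number_commutator)
  ultimately show "\<exists>C d'. derivation N d' \<and> approximately_inner N d' \<and>
      (\<forall>a\<in>BDT_alg N. d a = C \<cdot>\<^sub>C number_commutator a + d' a)"
    by (intro exI[of _ C] exI[of _ "\<lambda>a. d a - C \<cdot>\<^sub>C number_commutator a"]) simp
next
  fix C1 C2
  assume "\<exists>d'. derivation N d' \<and> approximately_inner N d' \<and>
      (\<forall>a\<in>BDT_alg N. d a = C1 \<cdot>\<^sub>C number_commutator a + d' a)"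
    and "\<exists>d'. derivation N d' \<and> approximately_inner N d' \<and>
      (\<forall>a\<in>BDT_alg N. d a = C2 \<cdot>\<^sub>C number_commutator a + d' a)"
  then show "C1 = C2"
    using number_commutator_coefficient_unique[of N _ _ C1 C2] shift_in_BDT_alg by metis
qed

end
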